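(* Let $N\ge 1$, $m\geq 2$, let $T_1,\dots,T_m$ be non-singular linear contractions on $\mathbb{R}^N$, and let $\mu$ be a Bernoulli measure on $I_\infty=\{1,\dots,m\}^{\mathbb{N}}$ with probabilities $p_1,\dots,p_m>0$, $\sum_{i=1}^m p_i=1$. Let $\omega=\{\omega_{\mathbf{i}}:\mathbf{i}\in I\}$ be any family of translation vectors in $\mathbb{R}^N$ for which there is a non-empty compact set $B\subset\mathbb{R}^N$ with $T_{i_k}(B)+\omega_{i_1,\dots,i_k}\subseteq B$ for all $k\ge1$ and all $(i_1,\dots,i_k)\in I_k$, and let $\mu^\omega$ be the projection of $\mu$ onto the almost self-affine set $E^\omega$. Then $$\limsup_{r\to0}\frac{\log\mu^\omega(B(x,r))}{\log r}\le\min\{d_1,N\}$$ for $\mu^\omega$-almost all $x\in\mathbb{R}^N$.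
   Context: A linear contraction is a linear map of Euclidean operator norm less than $1$. $B(x,r)$ is the closed ball with centre $x$ and radius $r$. Code space: $I_k=\{1,\dots,m\}^k$, $I=\bigcup_{k\ge0}I_k$, $I_\infty=\{1,\dots,m\}^{\mathbb{N}}$; for $\mathbf{i}\in I$, $|\mathbf{i}|$ is its length and $C_{\mathbf{i}}\subset I_\infty$ is the cylinder of all infinite sequences beginning with $\mathbf{i}$. The Bernoulli measure $\mu$ is the Borel probability measure on $I_\infty$ with $\mu(C_{\mathbf{i}})=p_{i_1}\cdots p_{i_k}$ for $\mathbf{i}=(i_1,\dots,i_k)$. For $\mathbf{i}=(i_1,\dots,i_k)\in I$ write $T_{\mathbf{i}}=T_{i_1}\cdots T_{i_k}$. Almost self-affine sets and measures: for $\mathbf{i}=(i_1,i_2,\dots)\in I_\infty$ let $$x^\omega(\mathbf{i})=\omega_{i_1}+T_{i_1}\omega_{i_1,i_2}+T_{i_1}T_{i_2}\omega_{i_1,i_2,i_3}+\cdots.$$ Then $E^\omega=\{x^\omega(\mathbf{i}):\mathbf{i}\in I_\infty\}$, a compact set, and $\mu^\omega(A)=\mu\{\mathbf{i}:x^\omega(\mathbf{i})\in A\}$. Singular value function: for a non-singular linear contraction $T$ with singular values $1>\alpha_1\ge\cdots\ge\alpha_N>0$ and $0<s\le N$, $\phi^s(T)=\alpha_1\cdots\alpha_{l-1}\alpha_l^{\,s-l+1}$ where $l$ is the integer with $l-1<s\le l$; $\phi^0(T)=1$; and $\phi^s(T)=(\alpha_1\cdots\alpha_N)^{s/N}$ for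 $s\ge N$. For $s\ge0$ let $$P(s,1)=\lim_{k\to\infty}\frac1k\sum_{|\mathbf{i}|=k}\mu(C_{\mathbf{i}})\log\big(\phi^s(T_{\mathbf{i}})^{-1}\mu(C_{\mathbf{i}})\big).$$ This limit exists, $P(\cdot,1)$ is continuous and strictly increasing in $s$, and $d_1>0$ is the unique number with $P(d_1,1)=0$. *)

theory Defs
  imports "HOL-Analysis.Analysis"
begin

section \<open>Code space\<close>

definition words :: "nat \<Rightarrow> nat \<Rightarrow> nat list set" where
  "words m k = {w. set w \<subseteq> {1..m} \<and> length w = k}"

definition code_space :: "nat \<Rightarrow> (nat \<Rightarrow> nat) set" where
  "code_space m = {u. \<forall>n. u n \<in> {1..m}}"

text \<open>Sequences are indexed from 0: the letter written \<open>i\<^sub>1\<close> in the mathematics is \<open>u 0\<close>.\<close>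

definition pref :: "(nat \<Rightarrow> nat) \<Rightarrow> nat \<Rightarrow> nat list" where
  "pref u k = map u [0..<k]"

definition cylinder :: "nat \<Rightarrow> nat list \<Rightarrow> (nat \<Rightarrow> nat) set" where
  "cylinder m w = {u \<in> code_space m. pref u (length w) = w}"

text \<open>The topology on \<^typ>\<open>nat \<Rightarrow> nat\<close> is the product of the discrete topologies, so the
  \<open>\<sigma>\<close>-algebra below is the Borel \<open>\<sigma>\<close>-algebra of the code space.\<close>

definition bernoulli_measure ::
    "nat \<Rightarrow> (nat \<Rightarrow> real) \<Rightarrow> (nat \<Rightarrow> nat) measure \<Rightarrow> bool" where
  "bernoulli_measure m p \<mu> \<longleftrightarrow>
     sets \<mu> = sets (restrict_space borel (code_space m)) \<and>
     emeasure \<mu> (space \<mu>) = 1 \<and>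
     (\<forall>k. \<forall>w\<in>words m k. measure \<mu> (cylinder m w) = prod_list (map p w))"


section \<open>Linear contractions and the singular value function\<close>

definition linear_contraction :: "(real^'n \<Rightarrow> real^'n) \<Rightarrow> bool" where
  "linear_contraction f \<longleftrightarrow> linear f \<and> onorm f < 1"

text \<open>The singular values are the non-negative square roots of the eigenvalues of \<open>f\<^sup>* f\<close>, each
  repeated according to multiplicity. As \<open>f\<^sup>* f\<close> is self-adjoint, the multiplicity of an
  eigenvalue is the dimension of its eigenspace.\<close>

definition sv_eigenspace :: "(real^'n \<Rightarrow> real^'n) \<Rightarrow> real \<Rightarrow> (real^'n) set" where
  "sv_eigenspace f a = {v. adjoint f (f v) = a\<^sup>2 *\<^sub>R v}"

definition sv_set :: "(real^'n \<Rightarrow> real^'n) \<Rightarrow> real set" where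
  "sv_set f = {a. 0 \<le> a \<and> (\<exists>v. v \<noteq> 0 \<and> v \<in> sv_eigenspace f a)}"

definition singular_values :: "(real^'n \<Rightarrow> real^'n) \<Rightarrow> real list" where
  "singular_values f =
     concat (map (\<lambda>a. replicate (dim (sv_eigenspace f a)) a)
       (rev (sorted_list_of_set (sv_set f))))"

text \<open>Singular values in decreasing order, numbered from 1 to \<^term>\<open>CARD('n)\<close>.\<close>

definition sv :: "(real^'n \<Rightarrow> real^'n) \<Rightarrow> nat \<Rightarrow> real" where
  "sv f j = singular_values f ! (j - 1)"

definition svf :: "real \<Rightarrow> (real^'n \<Rightarrow> real^'n) \<Rightarrow> real" where
  "svf s f =
     (if s = 0 then 1
      else if s \<le> real CARD('n) then
        (let l = nat \<lceil>s\<rceil> in (\<Prod>j=1..<l. sv f j) * sv f l powr (s - real l + 1))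
      else (\<Prod>j=1..CARD('n). sv f j) powr (s / real CARD('n)))"


section \<open>Almost self-affine sets and measures\<close>

definition word_map :: "(nat \<Rightarrow> real^'n \<Rightarrow> real^'n) \<Rightarrow> nat list \<Rightarrow> real^'n \<Rightarrow> real^'n" where
  "word_map T w = foldr (\<lambda>i g. T i \<circ> g) w id"

definition proj_pt ::
    "(nat \<Rightarrow> real^'n \<Rightarrow> real^'n) \<Rightarrow> (nat list \<Rightarrow> real^'n) \<Rightarrow> (nat \<Rightarrow> nat) \<Rightarrow> real^'n" where
  "proj_pt T \<omega> u = (\<Sum>k. word_map T (pref u k) (\<omega> (pref u (Suc k))))"

definition proj_measure ::
    "(nat \<Rightarrow> real^'n \<Rightarrow> real^'n) \<Rightarrow> (nat list \<Rightarrow> real^'n) \<Rightarrow> (nat \<Rightarrow> nat) measure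
      \<Rightarrow> (real^'n) measure" where
  "proj_measure T \<omega> \<mu> = distr \<mu> borel (proj_pt T \<omega>)"


section \<open>The pressure and its zero\<close>

definition pressure ::
    "nat \<Rightarrow> (nat \<Rightarrow> real^'n \<Rightarrow> real^'n) \<Rightarrow> (nat \<Rightarrow> nat) measure \<Rightarrow> real \<Rightarrow> real" where
  "pressure m T \<mu> s =
     lim (\<lambda>k. 1 / real k *
       (\<Sum>w\<in>words m k. measure \<mu> (cylinder m w) *
          ln (inverse (svf s (word_map T w)) * measure \<mu> (cylinder m w))))"

definition pressure_zero ::
    "nat \<Rightarrow> (nat \<Rightarrow> real^'n \<Rightarrow> real^'n) \<Rightarrow> (nat \<Rightarrow> nat) measure \<Rightarrow> real" where
  "pressure_zero m T \<mu> = (THE d. 0 < d \<and> pressure m T \<mu> d = 0)"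

text \<open>The library sets \<^term>\<open>ln (0::real) = 0\<close>, which would make the local dimension small
  at points outside the support of a measure; here the logarithm of 0 is \<^term>\<open>-\<infinity> :: ereal\<close>.\<close>

definition eln :: "real \<Rightarrow> ereal" where
  "eln t = (if t = 0 then -\<infinity> else ereal (ln t))"

end

theory Submission
  imports Defs
begin

text \<open>
  The point \<open>x(u)\<close> of a sequence \<open>u\<close> in a cylinder \<open>w\<close> lies in a fixed translate of \<open>T\<^sub>w\<close> of a
  large ball. For \<open>l - 1 < s \<le> l\<close> this set is covered by a constant times \<open>\<phi>\<^sup>s(T\<^sub>w) \<alpha>\<^sub>l(T\<^sub>w)\<^sup>-\<^sup>s\<close>
  balls of radius about \<open>\<alpha>\<^sub>l(T\<^sub>w)\<close>. The points of the cylinder in balls of mass much less than their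
  share \<open>\<mu>(C\<^sub>w) \<alpha>\<^sub>l(T\<^sub>w)\<^sup>s / \<phi>\<^sup>s(T\<^sub>w)\<close> are negligible by Borel-Cantelli. If \<open>P(s,1) > 0\<close>, then almost
  surely \<open>\<mu>(C\<^sub>w) \<ge> \<phi>\<^sup>s(T\<^sub>w)\<close> for all long prefixes \<open>w\<close> of \<open>u\<close> whose length is a multiple of a fixed
  \<open>k\<close>, so the share is at least \<open>\<alpha>\<^sub>l(T\<^sub>w)\<^sup>s\<close> and the upper local dimension is at most \<open>s\<close>; let
  \<open>s\<close> decrease to \<open>d\<^sub>1\<close>. The bound by \<open>N\<close> is the same argument with coverings of one fixed ball.
\<close>

section \<open>Singular value decomposition\<close>

text \<open>The radius used for a covering depends on the word, so each sequence is followed along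
  its own scales. This suffices because appending \<open>k\<close> letters shrinks the scale by at
  most a fixed factor, so that every small radius is comparable to some scale of the sequence.
  Covering constants and the summable factor demanded by Borel-Cantelli cost only an arbitrarily
  small power of the radius, paid for by the gap between \<open>s\<close> and the exponent to be
  reached. The singular value function is compared with covering numbers from above and from below,
  which makes it submultiplicative up to a constant; the constant vanishes after division by
  \<open>k\<close> in the pressure. Since \<open>pressure_zero\<close> is a definite description,
  the existence of the limit and the existence and uniqueness of its zero have to be proved too.
  They follow from superadditivity up to a constant and from bounds on the growth of the pressure in
  \<open>s\<close>.\<close>

lemma self_adjoint_orthonormal_eigenvectors:
  fixes g :: "'a::euclidean_space \<Rightarrow> 'a"
  assumes lin: "linear g" and sa: "\<And>x y. g x \<bullet> y = x \<bullet> g y"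
    and "subspace S" "g ` S \<subseteq> S"
  shows "\<exists>E\<subseteq>S. finite E \<and> card E = dim S \<and> pairwise orthogonal E \<and>
           (\<forall>e\<in>E. norm e = 1 \<and> (\<exists>c. g e = c *\<^sub>R e))"
  using assms(3,4)
proof (induction "dim S" arbitrary: S)
  case 0
  then show ?case by (intro exI[of _ "{}"]) auto
next
  case (Suc d)
  interpret g: linear g by (rule lin)
  from Suc.hyps(2) obtain z where z: "z \<in> S" "z \<noteq> 0"
    by (metis dim_eq_0 nat.distinct(1) singletonI subsetI)
  let ?K = "sphere 0 1 \<inter> S"
  have "compact ?K"
    using closed_subspace[OF Suc.prems(1)] by (intro compact_Int_closed) auto
  moreover have "z /\<^sub>R norm z \<in> ?K"
    using z Suc.prems(1) by (auto simp: subspace_scale)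
  moreover have "continuous_on ?K (\<lambda>x. g x \<bullet> x)"
    by (intro continuous_intros linear_continuous_on) (simp add: lin linear_conv_bounded_linear[symmetric])
  ultimately obtain e where e: "e \<in> ?K" and emax: "\<And>y. y \<in> ?K \<Longrightarrow> g y \<bullet> y \<le> g e \<bullet> e"
    using continuous_attains_sup[of ?K "\<lambda>x. g x \<bullet> x"] by blast
  define c where "c = g e \<bullet> e"
  have eS: "e \<in> S" and ne: "norm e = 1" and ee: "e \<bullet> e = 1"
    using e by (auto simp: norm_eq_1)
  have le: "g x \<bullet> x \<le> c * (x \<bullet> x)" if "x \<in> S" for x
  proof (cases "x = 0")
    case False
    then have "x /\<^sub>R norm x \<in> ?K" using that Suc.prems(1) by (auto simp: subspace_scale)
    from emax[OF this] False show ?thesis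
      by (simp add: g.scaleR c_def divide_simps power2_norm_eq_inner[symmetric] power2_eq_square mult_ac)
  qed simp
  have perp: "g e \<bullet> y = 0" if y: "y \<in> S" "e \<bullet> y = 0" for y
  proof -
    define D where "D = c * (y \<bullet> y) - g y \<bullet> y"
    define b where "b = g e \<bullet> y"
    have D0: "D \<ge> 0" using le[OF y(1)] by (simp add: D_def)
    \<comment> \<open>Maximality at \<open>e\<close>, tested at \<open>e + t *\<^sub>R y\<close>:
      the constant terms cancel and a quadratic inequality in \<open>t\<close> remains. The choice
      \<open>t = b / (D + 1)\<close> then forces \<open>b = 0\<close>; adding 1 keeps the
      denominator positive.\<close>
    have "2 * t * b \<le> t\<^sup>2 * D" for t
    proof -
      have "e + t *\<^sub>R y \<in> S" using eS y Suc.prems(1) by (auto simp: subspace_add subspace_scale)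
      from le[OF this] show ?thesis using y(2) ee sa[of y e]
        by (simp add: g.add g.scaleR inner_add_left inner_add_right b_def D_def c_def power2_eq_square
            inner_commute algebra_simps)
    qed
    from mult_right_mono[OF this[of "b / (D + 1)"], of "(D + 1)\<^sup>2"]
    have "2 * b\<^sup>2 * (D + 1) \<le> b\<^sup>2 * D"
      using D0 by (simp add: power_divide power2_eq_square)
    then have "b\<^sup>2 * (D + 2) \<le> 0" by (simp add: algebra_simps)
    with D0 have "b\<^sup>2 \<le> 0" by (smt (verit) mult_pos_pos)
    then show ?thesis by (simp add: b_def)
  qed
  have eig: "g e = c *\<^sub>R e"
  proof -
    \<comment> \<open>The part of \<open>g e\<close> orthogonal to \<open>e\<close> lies in
      \<open>S\<close>, so \<open>perp\<close> makes it orthogonal to \<open>g e\<close> and hence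
      to itself.\<close>
    let ?y = "g e - c *\<^sub>R e"
    have yS: "?y \<in> S" using Suc.prems eS by (auto simp: subspace_diff subspace_scale)
    have ey: "e \<bullet> ?y = 0" using ee by (simp add: inner_diff_right c_def inner_commute)
    have "?y \<bullet> ?y = g e \<bullet> ?y - c * (e \<bullet> ?y)" by (simp add: inner_diff_left)
    then have "?y \<bullet> ?y = 0" using perp[OF yS ey] ey by simp
    then show ?thesis by simp
  qed
  let ?S = "{x \<in> S. e \<bullet> x = 0}"
  have sub: "subspace ?S"
    using Suc.prems(1) by (auto simp: subspace_def inner_add_right)
  have inv: "g ` ?S \<subseteq> ?S"
    using Suc.prems(2) by (auto simp: sa[symmetric] eig)
  have "?S = {y \<in> S. \<forall>x \<in> span {e}. orthogonal x y}"
    by (auto simp: span_singleton orthogonal_def)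
  then have "dim ?S + dim {e} = dim S"
    using dim_subspace_orthogonal_to_vectors[of "span {e}" S] eS Suc.prems(1)
    by (simp add: span_minimal)
  moreover have "dim {e} = 1" using ne by (auto simp: dim_insert)
  ultimately have d: "d = dim ?S" using Suc.hyps(2) by simp
  from Suc.hyps(1)[OF d sub inv] obtain E where E: "E \<subseteq> ?S" "finite E" "card E = d"
    "pairwise orthogonal E" "\<forall>e\<in>E. norm e = 1 \<and> (\<exists>c. g e = c *\<^sub>R e)" using d by auto
  have "e \<notin> E" using E(1) ee by auto
  then show ?case
    using E eS ne eig Suc.hyps(2)
    by (intro exI[of _ "insert e E"]) (auto simp: pairwise_insert orthogonal_def inner_commute)
qed

lemma sorted_wrt_concat_replicate:
  assumes "sorted_wrt R xs" "\<And>x. R x x"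
  shows "sorted_wrt R (concat (map (\<lambda>a. replicate (n a) a) xs))"
  using assms(1)
proof (induction xs)
  case (Cons a xs)
  have "sorted_wrt R (replicate k a)" for k
    by (induction k) (auto simp: assms(2))
  with Cons show ?case by (auto simp: sorted_wrt_append)
qed simp

text \<open>The basis vectors are numbered from 0, the singular values from 1.\<close>

definition singular_basis :: "(real^'n \<Rightarrow> real^'n) \<Rightarrow> (nat \<Rightarrow> real^'n) \<Rightarrow> bool" where
  "singular_basis f e \<longleftrightarrow>
     (\<forall>i<CARD('n). \<forall>j<CARD('n). e i \<bullet> e j = (if i = j then 1 else 0)) \<and>
     (\<forall>i<CARD('n). \<forall>j<CARD('n). f (e i) \<bullet> f (e j) = (if i = j then (sv f (Suc i))\<^sup>2 else 0))"

text \<open>Ties the definition by eigenspace dimensions to geometry. In an orthonormal eigenbasis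
  of \<open>?g\<close>, the eigenvalue of \<open>e\<close> is the square of
  \<open>norm (f e)\<close>, and the eigenspace for \<open>a\<close> is spanned by the
  \<open>e\<close> with \<open>norm (f e) = a\<close>. Sorting the basis by these norms reproduces
  the list with its multiplicities.\<close>

lemma orthonormal_list_of_singular_values:
  fixes f :: "real^'n \<Rightarrow> real^'n"
  assumes lin: "linear f"
  shows "\<exists>es. distinct es \<and> length es = CARD('n) \<and> pairwise orthogonal (set es) \<and>
           (\<forall>x\<in>set es. norm x = 1) \<and> pairwise (\<lambda>x y. orthogonal (f x) (f y)) (set es) \<and>
           map (\<lambda>x. norm (f x)) es = singular_values f"
proof -
  let ?g = "\<lambda>x. adjoint f (f x)"
  have adj: "adjoint f x \<bullet> y = x \<bullet> f y" "x \<bullet> adjoint f y = f x \<bullet> y" for x y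
    by (simp_all add: adjoint_clauses[OF lin])
  have ling: "linear ?g"
    using linear_compose[OF lin adjoint_linear[OF lin]] by (simp add: o_def)
  obtain E where E: "finite E" "card E = CARD('n)" "pairwise orthogonal E"
     "\<And>e. e \<in> E \<Longrightarrow> norm e = 1" "\<And>e. e \<in> E \<Longrightarrow> \<exists>c. ?g e = c *\<^sub>R e"
    using self_adjoint_orthonormal_eigenvectors[OF ling, of UNIV] by (auto simp: adj)
  have ind: "independent E"
    using E(3,4) by (intro pairwise_orthogonal_independent) force+
  have span: "span E = UNIV"
    using E(2) ind by (metis DIM_cart DIM_real dim_eq_full dim_eq_card_independent mult.right_neutral)
  have eig: "?g e = (norm (f e))\<^sup>2 *\<^sub>R e" if "e \<in> E" for e
  proof -
    obtain c where c: "?g e = c *\<^sub>R e" using E(5)[OF \<open>e \<in> E\<close>] by blast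
    have "(norm (f e))\<^sup>2 = ?g e \<bullet> e" by (simp add: adj power2_norm_eq_inner)
    also have "\<dots> = c" using E(4)[OF that] by (simp add: c norm_eq_1)
    finally show ?thesis using c by simp
  qed
  have forth: "pairwise (\<lambda>x y. orthogonal (f x) (f y)) E"
  proof (rule pairwiseI)
    fix x y assume xy: "x \<in> E" "y \<in> E" "x \<noteq> y"
    have "f x \<bullet> f y = ?g x \<bullet> y" by (simp add: adj)
    also have "\<dots> = 0" using xy E(3) by (simp add: eig pairwise_def orthogonal_def)
    finally show "orthogonal (f x) (f y)" by (simp add: orthogonal_def)
  qed
  define EE where "EE = (\<lambda>a. {e \<in> E. norm (f e) = a})"
  have space: "sv_eigenspace f a = span (EE a)" if "a \<ge> 0" for a
  proof
    have "EE a \<subseteq> sv_eigenspace f a" by (auto simp: EE_def sv_eigenspace_def eig)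
    moreover have "subspace (sv_eigenspace f a)"
      using linear_add[OF ling] linear_scale[OF ling] linear_0[OF ling]
      by (auto simp: sv_eigenspace_def subspace_def algebra_simps)
    ultimately show "span (EE a) \<subseteq> sv_eigenspace f a" by (rule span_minimal)
    show "sv_eigenspace f a \<subseteq> span (EE a)"
    proof
      fix v assume "v \<in> sv_eigenspace f a"
      then have v: "?g v = a\<^sup>2 *\<^sub>R v" by (simp add: sv_eigenspace_def)
      \<comment> \<open>Eigenvectors for different eigenvalues are orthogonal. Only squares are
        compared, so \<open>a \<ge> 0\<close> is what separates \<open>a\<close> from
        \<open>norm (f e)\<close>.\<close>
      have 0: "v \<bullet> e = 0" if "e \<in> E" "norm (f e) \<noteq> a" for e
      proof -
        have "a\<^sup>2 * (v \<bullet> e) = ?g v \<bullet> e" by (simp add: v)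
        also have "\<dots> = v \<bullet> ?g e" by (simp add: adj)
        also have "\<dots> = (norm (f e))\<^sup>2 * (v \<bullet> e)" by (simp add: eig that)
        finally show ?thesis using that \<open>a \<ge> 0\<close> by (simp add: power2_eq_iff_nonneg)
      qed
      have "v = (\<Sum>e\<in>E. (v \<bullet> e) *\<^sub>R e)"
        using orthonormal_basis_expand[OF E(3,4) _ E(1), of v] span by simp
      also have "\<dots> = (\<Sum>e\<in>EE a. (v \<bullet> e) *\<^sub>R e)"
        using 0 E(1) by (intro sum.mono_neutral_right) (auto simp: EE_def)
      also have "\<dots> \<in> span (EE a)" by (intro span_sum span_scale span_base)
      finally show "v \<in> span (EE a)" .
    qed
  qed
  have finEE: "finite (EE a)" for a using E(1) by (simp add: EE_def)
  have dimE: "dim (sv_eigenspace f a) = card (EE a)" if "a \<ge> 0" for a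
    using ind that by (simp add: space dim_eq_card_independent independent_mono EE_def)
  have set: "sv_set f = (\<lambda>e. norm (f e)) ` E"
  proof -
    have "(\<exists>v. v \<noteq> 0 \<and> v \<in> span (EE a)) \<longleftrightarrow> EE a \<noteq> {}" for a
    proof
      assume "EE a \<noteq> {}"
      then obtain e where "e \<in> EE a" by blast
      moreover from this have "e \<noteq> 0" using E(4) by (force simp: EE_def)
      ultimately show "\<exists>v. v \<noteq> 0 \<and> v \<in> span (EE a)" using span_base by blast
    qed auto
    then have "sv_set f = {a. a \<ge> 0 \<and> EE a \<noteq> {}}"
      by (auto simp: sv_set_def space)
    then show ?thesis by (simp only:) (auto simp: EE_def)
  qed
  have "\<exists>L. set L = EE a \<and> distinct L" for a using finite_distinct_list[OF finEE] by blast
  then obtain L where L: "\<And>a. set (L a) = EE a" "\<And>a. distinct (L a)" by metis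
  let ?as = "rev (sorted_list_of_set (sv_set f))"
  have as: "set ?as = sv_set f" "distinct ?as" using set E(1) by auto
  define es where "es = concat (map L ?as)"
  have setes: "set es = E" by (auto simp: es_def L EE_def set E(1))
  have "distinct (concat (map L xs))" if "distinct xs" for xs
    using that by (induction xs) (auto simp: L EE_def)
  then have dist: "distinct es" using as by (simp add: es_def)
  moreover have "length es = CARD('n)" using dist setes E(2) by (metis distinct_card)
  moreover have "map (\<lambda>x. norm (f x)) es = singular_values f"
  proof -
    have "map (\<lambda>x. norm (f x)) (L a) = replicate (dim (sv_eigenspace f a)) a" if "a \<ge> 0" for a
      using L[of a] distinct_card[of "L a"] dimE[OF that]
      by (intro replicate_eqI) (auto simp: EE_def)
    moreover have "\<forall>a\<in>set ?as. a \<ge> 0" using as by (auto simp: sv_set_def)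
    ultimately show ?thesis
      unfolding es_def singular_values_def map_concat map_map
      by (intro arg_cong[of _ _ concat] map_cong) auto
  qed
  ultimately show ?thesis using E(3,4) forth setes by (intro exI[of _ es]) auto
qed

lemma singular_basis_exists:
  fixes f :: "real^'n \<Rightarrow> real^'n"
  assumes "linear f"
  obtains e where "singular_basis f e"
proof -
  obtain es where es: "distinct es" "length es = CARD('n)" "pairwise orthogonal (set es)"
    "\<forall>x\<in>set es. norm x = 1" "pairwise (\<lambda>x y. orthogonal (f x) (f y)) (set es)"
    "map (\<lambda>x. norm (f x)) es = singular_values f"
    using orthonormal_list_of_singular_values[OF assms] by blast
  have sv: "sv f (Suc i) = norm (f (es ! i))" if "i < CARD('n)" for i
    using es(2) that by (simp add: sv_def es(6)[symmetric])
  have "singular_basis f (\<lambda>i. es ! i)"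
    using es(1-5) unfolding singular_basis_def
    by (auto simp: sv pairwise_def orthogonal_def nth_eq_iff_index_eq power2_norm_eq_inner norm_eq_1)
  then show ?thesis by (rule that)
qed

lemma length_singular_values:
  fixes f :: "real^'n \<Rightarrow> real^'n"
  assumes "linear f"
  shows "length (singular_values f) = CARD('n)"
  using orthonormal_list_of_singular_values[OF assms] by (metis length_map)

lemma sv_nonneg:
  fixes f :: "real^'n \<Rightarrow> real^'n"
  assumes "linear f" "i < CARD('n)"
  shows "0 \<le> sv f (Suc i)"
  using orthonormal_list_of_singular_values[OF assms(1)] assms(2)
  by (metis diff_Suc_1 length_map norm_ge_zero nth_map sv_def)

lemma sv_antimono:
  fixes f :: "real^'n \<Rightarrow> real^'n"
  assumes "linear f" "i \<le> j" "j < CARD('n)"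
  shows "sv f (Suc j) \<le> sv f (Suc i)"
proof (cases "i = j")
  case False
  have "sorted_wrt (\<ge>) (singular_values f)"
    unfolding singular_values_def
    by (intro sorted_wrt_concat_replicate) (auto simp: sorted_wrt_rev)
  with False assms show ?thesis
    unfolding sv_def by (simp add: sorted_wrt_iff_nth_less length_singular_values)
qed simp

lemma singular_basis_inner:
  fixes f :: "real^'n \<Rightarrow> real^'n"
  assumes "singular_basis f e" "i < CARD('n)" "j < CARD('n)"
  shows "e i \<bullet> e j = (if i = j then 1 else 0)"
    and "f (e i) \<bullet> f (e j) = (if i = j then (sv f (Suc i))\<^sup>2 else 0)"
  using assms unfolding singular_basis_def by auto

lemma singular_basis_norm:
  fixes f :: "real^'n \<Rightarrow> real^'n"
  assumes "linear f" "singular_basis f e" "i < CARD('n)"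
  shows "norm (e i) = 1" and "norm (f (e i)) = sv f (Suc i)"
  using singular_basis_inner[OF assms(2,3,3)] sv_nonneg[OF assms(1,3)]
  by (simp_all add: norm_eq_sqrt_inner)

lemma singular_basis_inj:
  fixes f :: "real^'n \<Rightarrow> real^'n"
  assumes "singular_basis f e"
  shows "inj_on e {..<CARD('n)}"
  by (intro inj_onI) (metis assms lessThan_iff singular_basis_inner(1) zero_neq_one)

lemma singular_basis_independent:
  fixes f :: "real^'n \<Rightarrow> real^'n"
  assumes "singular_basis f e" "I \<subseteq> {..<CARD('n)}"
  shows "independent (e ` I)"
proof (rule pairwise_orthogonal_independent)
  show "pairwise orthogonal (e ` I)"
    using assms(2)
    by (auto simp: pairwise_def orthogonal_def subset_iff singular_basis_inner(1)[OF assms(1)])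
  have "e i \<noteq> 0" if "i \<in> I" for i
    using singular_basis_inner(1)[OF assms(1), of i i] assms(2) that by auto
  then show "0 \<notin> e ` I" by force
qed

lemma singular_basis_expand:
  fixes f :: "real^'n \<Rightarrow> real^'n"
  assumes "singular_basis f e"
  shows "(\<Sum>i<CARD('n). (x \<bullet> e i) *\<^sub>R e i) = x"
proof -
  let ?E = "e ` {..<CARD('n)}"
  note inj = singular_basis_inj[OF assms] and ind = singular_basis_independent[OF assms order_refl]
  have "card ?E = CARD('n)" using inj by (simp add: card_image)
  then have "span ?E = UNIV"
    using ind by (metis DIM_cart DIM_real dim_eq_full dim_eq_card_independent mult.right_neutral)
  moreover have "pairwise orthogonal ?E"
    using singular_basis_inner(1)[OF assms] by (force simp: pairwise_def orthogonal_def)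
  moreover have "norm y = 1" if "y \<in> ?E" for y
    using that singular_basis_inner(1)[OF assms] by (auto simp: norm_eq_1)
  ultimately have "(\<Sum>y\<in>?E. (x \<bullet> y) *\<^sub>R y) = x"
    by (intro orthonormal_basis_expand) auto
  then show ?thesis by (simp add: sum.reindex[OF inj] o_def)
qed

lemma singular_basis_inner_comb:
  fixes f :: "real^'n \<Rightarrow> real^'n"
  assumes "linear f" "singular_basis f e" "j < CARD('n)"
  shows "f (\<Sum>i<CARD('n). c i *\<^sub>R e i) \<bullet> f (e j) = c j * (sv f (Suc j))\<^sup>2"
proof -
  have "f (\<Sum>i<CARD('n). c i *\<^sub>R e i) \<bullet> f (e j) = (\<Sum>i<CARD('n). c i * (f (e i) \<bullet> f (e j)))"
    by (simp add: linear_sum[OF assms(1)] linear_scale[OF assms(1)] inner_sum_left)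
  also have "\<dots> = (\<Sum>i<CARD('n). if j = i then c i * (sv f (Suc j))\<^sup>2 else 0)"
    using assms(3) by (intro sum.cong refl) (auto simp: singular_basis_inner[OF assms(2)])
  finally show ?thesis using assms(3) by simp
qed

lemma singular_basis_norm_sq:
  fixes f :: "real^'n \<Rightarrow> real^'n"
  assumes "linear f" "singular_basis f e"
  shows "(norm x)\<^sup>2 = (\<Sum>i<CARD('n). (x \<bullet> e i)\<^sup>2)"
    and "(norm (f x))\<^sup>2 = (\<Sum>i<CARD('n). (x \<bullet> e i)\<^sup>2 * (sv f (Suc i))\<^sup>2)"
proof -
  note ex = singular_basis_expand[OF assms(2), of x]
  have "x \<bullet> (\<Sum>i<CARD('n). (x \<bullet> e i) *\<^sub>R e i) = (\<Sum>i<CARD('n). (x \<bullet> e i)\<^sup>2)"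
    by (simp add: inner_sum_right power2_eq_square)
  then show "(norm x)\<^sup>2 = (\<Sum>i<CARD('n). (x \<bullet> e i)\<^sup>2)"
    by (simp only: ex power2_norm_eq_inner)
  have "f x \<bullet> f x = f x \<bullet> f (\<Sum>i<CARD('n). (x \<bullet> e i) *\<^sub>R e i)" by (simp add: ex)
  also have "\<dots> = (\<Sum>i<CARD('n). (x \<bullet> e i) * (f x \<bullet> f (e i)))"
    by (simp add: linear_sum[OF assms(1)] linear_scale[OF assms(1)] inner_sum_right)
  also have "\<dots> = (\<Sum>i<CARD('n). (x \<bullet> e i)\<^sup>2 * (sv f (Suc i))\<^sup>2)"
    using singular_basis_inner_comb[OF assms, of _ "\<lambda>i. x \<bullet> e i"]
    by (intro sum.cong refl) (simp add: ex power2_eq_square)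
  finally show "(norm (f x))\<^sup>2 = (\<Sum>i<CARD('n). (x \<bullet> e i)\<^sup>2 * (sv f (Suc i))\<^sup>2)"
    by (simp add: power2_norm_eq_inner)
qed

lemma singular_basis_span_inner:
  fixes f :: "real^'n \<Rightarrow> real^'n"
  assumes "singular_basis f e" "I \<subseteq> {..<CARD('n)}" "v \<in> span (e ` I)" "j < CARD('n)" "j \<notin> I"
  shows "v \<bullet> e j = 0"
  using assms(3)
proof (rule span_induct)
  show "subspace {v. v \<bullet> e j = 0}" by (simp add: subspace_def inner_add_left)
  show "v \<bullet> e j = 0" if "v \<in> e ` I" for v
    using that assms by (auto simp: singular_basis_inner(1)[OF assms(1)] subset_iff)
qed

section \<open>Min-max comparison of singular values\<close>

text \<open>The Courant-Fischer argument: the dimensions of \<open>U\<close> and of the image of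
  \<open>W\<close> under \<open>g\<close> add up to more than that of the space, so they share a
  nonzero vector. There \<open>f\<close> stretches by at least its own singular value, and
  \<open>f \<circ> g\<close> by at most its own. This keeps the scale of a word from dropping too
  fast when letters are appended on the right.\<close>

lemma sv_compose_ge:
  fixes f g :: "real^'n \<Rightarrow> real^'n"
  assumes f: "linear f" and g: "linear g" and b: "b > 0" "\<And>v. b * norm v \<le> norm (g v)"
    and i: "i < CARD('n)"
  shows "b * sv f (Suc i) \<le> sv (f \<circ> g) (Suc i)"
proof -
  have fg: "linear (f \<circ> g)" using linear_compose[OF g f] .
  obtain e where e: "singular_basis f e" by (rule singular_basis_exists[OF f])
  obtain e' where e': "singular_basis (f \<circ> g) e'" by (rule singular_basis_exists[OF fg])
  have "inj g"
    using b linear_injective_0[OF g] by (metis mult_pos_pos norm_le_zero_iff norm_zero not_le zero_less_norm_iff)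
  define U W where "U = span (e ` {..i})" and "W = span (e' ` {i..<CARD('n)})"
  have sub: "{..i} \<subseteq> {..<CARD('n)}" "{i..<CARD('n)} \<subseteq> {..<CARD('n)}" using i by auto
  have dU: "dim U = i + 1"
    using singular_basis_independent[OF e sub(1)] inj_on_subset[OF singular_basis_inj[OF e] sub(1)]
    by (simp add: U_def dim_eq_card_independent card_image)
  have "dim W = CARD('n) - i"
    using singular_basis_independent[OF e' sub(2)] inj_on_subset[OF singular_basis_inj[OF e'] sub(2)]
    by (simp add: W_def dim_eq_card_independent card_image)
  then have dW: "dim (g ` W) = CARD('n) - i"
    using \<open>inj g\<close> by (simp add: dim_image_eq[OF g] inj_on_subset)
  have "dim {x + y |x y. x \<in> U \<and> y \<in> g ` W} + dim (U \<inter> g ` W) = dim U + dim (g ` W)"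
    by (rule dim_sums_Int) (auto simp: U_def W_def linear_subspace_image[OF g])
  moreover have "dim {x + y |x y. x \<in> U \<and> y \<in> g ` W} \<le> CARD('n)"
    using dim_subset_UNIV[of "{x + y |x y. x \<in> U \<and> y \<in> g ` W}"] by simp
  ultimately have "dim (U \<inter> g ` W) \<noteq> 0" using dU dW i by linarith
  then obtain u where "u \<in> U" "u \<in> g ` W" "u \<noteq> 0" by (auto simp: dim_eq_0)
  then obtain w where w: "w \<in> W" "g w \<in> U" "g w \<noteq> 0" by auto
  then have "w \<noteq> 0" using linear_0[OF g] by auto
  have "(sv f (Suc i) * norm (g w))\<^sup>2 \<le> (norm (f (g w)))\<^sup>2"
    unfolding power_mult_distrib singular_basis_norm_sq(1)[OF f e, of "g w"]
      singular_basis_norm_sq(2)[OF f e, of "g w"] sum_distrib_left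
  proof (intro sum_mono)
    fix j assume j: "j \<in> {..<CARD('n)}"
    show "(sv f (Suc i))\<^sup>2 * (g w \<bullet> e j)\<^sup>2 \<le> (g w \<bullet> e j)\<^sup>2 * (sv f (Suc j))\<^sup>2"
    proof (cases "j \<le> i")
      case True
      then show ?thesis using sv_antimono[OF f True i] sv_nonneg[OF f i]
        by (simp add: mult.commute mult_right_mono power_mono)
    next
      case False
      then have "g w \<bullet> e j = 0"
        using w(2) i j by (intro singular_basis_span_inner[OF e, of "{..i}"]) (auto simp: U_def)
      then show ?thesis by simp
    qed
  qed
  then have 1: "sv f (Suc i) * norm (g w) \<le> norm (f (g w))"
    by (rule power2_le_imp_le) simp
  have "(norm ((f \<circ> g) w))\<^sup>2 \<le> (sv (f \<circ> g) (Suc i) * norm w)\<^sup>2"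
    unfolding power_mult_distrib singular_basis_norm_sq(1)[OF fg e', of w]
      singular_basis_norm_sq(2)[OF fg e', of w] sum_distrib_left
  proof (intro sum_mono)
    fix j assume j: "j \<in> {..<CARD('n)}"
    show "(w \<bullet> e' j)\<^sup>2 * (sv (f \<circ> g) (Suc j))\<^sup>2 \<le> (sv (f \<circ> g) (Suc i))\<^sup>2 * (w \<bullet> e' j)\<^sup>2"
    proof (cases "i \<le> j")
      case True
      then have "(sv (f \<circ> g) (Suc j))\<^sup>2 \<le> (sv (f \<circ> g) (Suc i))\<^sup>2"
        using sv_antimono[OF fg True] sv_nonneg[OF fg, of j] j by (intro power_mono) auto
      then show ?thesis by (subst mult.commute) (intro mult_right_mono, auto)
    next
      case False
      then have "w \<bullet> e' j = 0"
        using w(1) i j by (intro singular_basis_span_inner[OF e', of "{i..<CARD('n)}"]) (auto simp: W_def)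
      then show ?thesis by simp
    qed
  qed
  then have 2: "norm (f (g w)) \<le> sv (f \<circ> g) (Suc i) * norm w"
    using sv_nonneg[OF fg i] by (auto dest: power2_le_imp_le)
  have "sv f (Suc i) * (b * norm w) \<le> sv f (Suc i) * norm (g w)"
    using sv_nonneg[OF f i] b(2) by (rule mult_left_mono[rotated])
  with 1 2 have "(b * sv f (Suc i)) * norm w \<le> sv (f \<circ> g) (Suc i) * norm w"
    by (simp add: mult_ac)
  then show ?thesis using \<open>w \<noteq> 0\<close> by simp
qed

lemma sv_lower:
  fixes f :: "real^'n \<Rightarrow> real^'n"
  assumes "linear f" "\<And>v. b * norm v \<le> norm (f v)" "i < CARD('n)"
  shows "b \<le> sv f (Suc i)"
proof -
  obtain e where e: "singular_basis f e" by (rule singular_basis_exists[OF assms(1)])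
  show ?thesis using assms(2)[of "e i"] singular_basis_norm[OF assms(1) e assms(3)] by simp
qed

lemma sv_upper:
  fixes f :: "real^'n \<Rightarrow> real^'n"
  assumes "linear f" "\<And>v. norm (f v) \<le> a * norm v" "i < CARD('n)"
  shows "sv f (Suc i) \<le> a"
proof -
  obtain e where e: "singular_basis f e" by (rule singular_basis_exists[OF assms(1)])
  show ?thesis using assms(2)[of "e i"] singular_basis_norm[OF assms(1) e assms(3)] by simp
qed

lemma sv_pos:
  fixes f :: "real^'n \<Rightarrow> real^'n"
  assumes "linear f" "inj f" "i < CARD('n)"
  shows "0 < sv f (Suc i)"
proof -
  obtain e where e: "singular_basis f e" by (rule singular_basis_exists[OF assms(1)])
  have "e i \<noteq> 0" using singular_basis_norm[OF assms(1) e assms(3)] by auto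
  then have "f (e i) \<noteq> 0" using assms(1,2) linear_injective_0 by blast
  then show ?thesis using singular_basis_norm[OF assms(1) e assms(3)] by (metis zero_less_norm_iff)
qed

section \<open>Coverings of ellipsoids and the singular value function\<close>

lemma ellipsoid_cover:
  fixes f :: "real^'n \<Rightarrow> real^'n"
  assumes f: "linear f" "inj f" and rho: "\<rho> > 0"
  obtains X where "finite X" "real (card X) \<le> (\<Prod>i<CARD('n). 4 * max 1 (sv f (Suc i) / \<rho>))"
    "f ` cball 0 1 \<subseteq> (\<Union>x\<in>X. cball x (real CARD('n) * \<rho>))"
proof -
  obtain e where e: "singular_basis f e" by (rule singular_basis_exists[OF f(1)])
  define \<alpha> where "\<alpha> i = sv f (Suc i)" for i
  have pos: "\<alpha> i > 0" if "i < CARD('n)" for i using sv_pos[OF f that] by (simp add: \<alpha>_def)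
  define K where "K i = {\<lfloor>- (\<alpha> i / \<rho>)\<rfloor>..\<lfloor>\<alpha> i / \<rho>\<rfloor>}" for i
  \<comment> \<open>A grid of mesh \<open>\<rho>\<close> along the axes of the ellipsoid:
    \<open>f (e i)\<close> has length \<open>\<alpha> i\<close>, so dividing by it gives a unit
    direction. Rounding a coordinate down costs at most \<open>\<rho>\<close> per axis, which sums
    to the radius in the claim.\<close>
  define c where "c k = (\<Sum>i<CARD('n). (of_int (k i) * \<rho> / \<alpha> i) *\<^sub>R f (e i))" for k :: "nat \<Rightarrow> int"
  define X where "X = c ` PiE {..<CARD('n)} K"
  have finP: "finite (PiE {..<CARD('n)} K)" by (intro finite_PiE) (auto simp: K_def)
  have "real (card X) \<le> real (card (PiE {..<CARD('n)} K))"
    unfolding X_def using finP by (simp add: card_image_le)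
  also have "\<dots> = (\<Prod>i<CARD('n). real (card (K i)))" by (simp add: card_PiE)
  also have "\<dots> \<le> (\<Prod>i<CARD('n). 4 * max 1 (\<alpha> i / \<rho>))"
  proof (intro prod_mono conjI)
    fix i assume "i \<in> {..<CARD('n)}"
    then have "\<alpha> i / \<rho> > 0" using pos rho by simp
    then have "real (card (K i)) = of_int (\<lfloor>\<alpha> i / \<rho>\<rfloor> - \<lfloor>- (\<alpha> i / \<rho>)\<rfloor> + 1)"
      unfolding K_def by (simp add: of_nat_nat floor_mono)
    \<comment> \<open>For \<open>y = \<alpha> i / \<rho>\<close> the interval contains at most
      \<open>2 * y + 2\<close> integers, whence the factor 4.\<close>
    then show "real (card (K i)) \<le> 4 * max 1 (\<alpha> i / \<rho>)" by linarith
  qed simp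
  finally have card: "real (card X) \<le> (\<Prod>i<CARD('n). 4 * max 1 (\<alpha> i / \<rho>))" .
  have "f x \<in> (\<Union>x\<in>X. cball x (real CARD('n) * \<rho>))" if x: "x \<in> cball 0 1" for x
  proof -
    define k where "k = restrict (\<lambda>i. \<lfloor>(x \<bullet> e i) * \<alpha> i / \<rho>\<rfloor>) {..<CARD('n)}"
    have "k \<in> PiE {..<CARD('n)} K"
    proof
      fix i assume i: "i \<in> {..<CARD('n)}"
      have "\<bar>x \<bullet> e i\<bar> \<le> norm x * norm (e i)" by (rule Cauchy_Schwarz_ineq2)
      also have "\<dots> \<le> 1" using x i singular_basis_norm[OF f(1) e] by simp
      finally have "\<bar>x \<bullet> e i\<bar> * (\<alpha> i / \<rho>) \<le> 1 * (\<alpha> i / \<rho>)"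
        using pos[of i] i rho by (intro mult_right_mono) auto
      moreover have "\<bar>x \<bullet> e i\<bar> * (\<alpha> i / \<rho>) = \<bar>(x \<bullet> e i) * \<alpha> i / \<rho>\<bar>"
        using pos[of i] i rho by (simp add: abs_mult)
      ultimately have "(x \<bullet> e i) * \<alpha> i / \<rho> \<le> \<alpha> i / \<rho>" "- (\<alpha> i / \<rho>) \<le> (x \<bullet> e i) * \<alpha> i / \<rho>"
        by linarith+
      from this[THEN floor_mono] show "k i \<in> K i" using i unfolding K_def k_def by simp
    qed (simp add: k_def)
    then have cX: "c k \<in> X" by (simp add: X_def)
    have "f x = (\<Sum>i<CARD('n). (x \<bullet> e i) *\<^sub>R f (e i))"
      using arg_cong[OF singular_basis_expand[OF e, of x], of f]
      by (simp add: linear_sum[OF f(1)] linear_scale[OF f(1)])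
    then have "f x - c k = (\<Sum>i<CARD('n). ((x \<bullet> e i) - of_int (k i) * \<rho> / \<alpha> i) *\<^sub>R f (e i))"
      by (simp add: c_def sum_subtractf scaleR_left_diff_distrib)
    also have "norm \<dots> \<le> (\<Sum>i<CARD('n). \<rho>)"
    proof (intro sum_norm_le)
      fix i assume "i \<in> {..<CARD('n)}"
      then have i: "i < CARD('n)" by simp
      define y where "y = (x \<bullet> e i) * \<alpha> i / \<rho>"
      have "norm (((x \<bullet> e i) - of_int (k i) * \<rho> / \<alpha> i) *\<^sub>R f (e i)) = \<bar>(x \<bullet> e i) - of_int (k i) * \<rho> / \<alpha> i\<bar> * \<alpha> i"
        using singular_basis_norm[OF f(1) e i] by (simp add: \<alpha>_def)
      also have "\<dots> = \<bar>((x \<bullet> e i) - of_int (k i) * \<rho> / \<alpha> i) * \<alpha> i\<bar>"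
        using pos[OF i] by (simp add: abs_mult)
      also have "((x \<bullet> e i) - of_int (k i) * \<rho> / \<alpha> i) * \<alpha> i = (y - of_int \<lfloor>y\<rfloor>) * \<rho>"
        using pos[OF i] i rho by (simp add: y_def k_def field_simps)
      also have "\<bar>(y - of_int \<lfloor>y\<rfloor>) * \<rho>\<bar> = (y - of_int \<lfloor>y\<rfloor>) * \<rho>" using rho by simp
      also have "\<dots> \<le> 1 * \<rho>"
        using rho by (intro mult_right_mono) linarith+
      finally show "norm (((x \<bullet> e i) - of_int (k i) * \<rho> / \<alpha> i) *\<^sub>R f (e i)) \<le> \<rho>" by simp
    qed
    finally have "dist (c k) (f x) \<le> real CARD('n) * \<rho>"
      by (simp add: dist_norm norm_minus_commute)
    then show ?thesis using cX by auto
  qed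
  then have "f ` cball 0 1 \<subseteq> (\<Union>x\<in>X. cball x (real CARD('n) * \<rho>))" by blast
  then show ?thesis using that[of X] finP card unfolding X_def \<alpha>_def by blast
qed

text \<open>A grid in the unit ball is chosen whose image points are at least
  \<open>3 * \<rho>\<close> apart. A ball of radius \<open>\<rho>\<close> has diameter
  \<open>2 * \<rho>\<close>, so it contains at most one of them.\<close>

lemma ellipsoid_packing:
  fixes f :: "real^'n \<Rightarrow> real^'n"
  assumes f: "linear f" "inj f" and rho: "\<rho> > 0"
    and X: "finite X" "f ` cball 0 1 \<subseteq> (\<Union>x\<in>X. cball x \<rho>)"
  shows "(\<Prod>i<CARD('n). max 1 (sv f (Suc i) / (3 * real CARD('n) * \<rho>))) \<le> real (card X)"
proof -
  obtain e where e: "singular_basis f e" by (rule singular_basis_exists[OF f(1)])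
  define \<alpha> where "\<alpha> i = sv f (Suc i)" for i
  have pos: "\<alpha> i > 0" if "i < CARD('n)" for i using sv_pos[OF f that] by (simp add: \<alpha>_def)
  \<comment> \<open>The dimension enters to keep the grid in the unit ball:
    \<open>k i \<le> \<alpha> i / c\<close> makes each coordinate at most
    \<open>1 / real CARD('n)\<close>.\<close>
  define c where "c = 3 * real CARD('n) * \<rho>"
  have c: "c > 0" using rho by (simp add: c_def)
  define K where "K i = {0..nat \<lfloor>\<alpha> i / c\<rfloor>}" for i
  define q where "q k = (\<Sum>i<CARD('n). (real (k i) * (3 * \<rho> / \<alpha> i)) *\<^sub>R e i)" for k :: "nat \<Rightarrow> nat"
  have "\<exists>x\<in>X. f (q k) \<in> cball x \<rho>" if k: "k \<in> PiE {..<CARD('n)} K" for k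
  proof -
    have "norm (q k) \<le> (\<Sum>i<CARD('n). 1 / real CARD('n))"
      unfolding q_def
    proof (intro sum_norm_le)
      fix i assume i: "i \<in> {..<CARD('n)}"
      have "k i \<in> K i" using k i by blast
      then have "real (k i) \<le> real (nat \<lfloor>\<alpha> i / c\<rfloor>)" unfolding K_def by simp
      also have "\<dots> \<le> \<alpha> i / c" using pos[of i] c i by (simp add: of_nat_nat)
      finally have "real (k i) * (3 * \<rho> / \<alpha> i) \<le> (\<alpha> i / c) * (3 * \<rho> / \<alpha> i)"
        using pos[of i] i rho by (intro mult_right_mono) auto
      also have "\<dots> = 1 / real CARD('n)" using pos[of i] i rho by (simp add: c_def)
      finally show "norm ((real (k i) * (3 * \<rho> / \<alpha> i)) *\<^sub>R e i) \<le> 1 / real CARD('n)"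
        using pos[of i] i rho singular_basis_norm[OF f(1) e] by (simp add: abs_mult)
    qed
    then have "q k \<in> cball 0 1" by simp
    then show ?thesis using X(2) by blast
  qed
  then obtain h where h: "\<And>k. k \<in> PiE {..<CARD('n)} K \<Longrightarrow> h k \<in> X"
      "\<And>k. k \<in> PiE {..<CARD('n)} K \<Longrightarrow> f (q k) \<in> cball (h k) \<rho>" by metis
  have "inj_on h (PiE {..<CARD('n)} K)"
  proof (rule inj_onI, rule ccontr)
    fix k k' assume k: "k \<in> PiE {..<CARD('n)} K" "k' \<in> PiE {..<CARD('n)} K" "h k = h k'" "k \<noteq> k'"
    then obtain i where i: "i < CARD('n)" "k i \<noteq> k' i"
      by (metis PiE_ext lessThan_iff)
    have "dist (f (q k)) (f (q k')) \<le> 2 * \<rho>"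
      using h(2)[OF k(1)] h(2)[OF k(2)] k(3) dist_triangle3[of "f (q k)" "f (q k')" "h k"] by simp
    then have "norm (f (q k) - f (q k')) * \<alpha> i \<le> 2 * \<rho> * \<alpha> i"
      using pos[OF i(1)] by (simp add: dist_norm)
    moreover have "\<bar>(f (q k) - f (q k')) \<bullet> f (e i)\<bar> \<le> norm (f (q k) - f (q k')) * \<alpha> i"
      using Cauchy_Schwarz_ineq2[of "f (q k) - f (q k')" "f (e i)"] singular_basis_norm[OF f(1) e i(1)]
      by (simp add: \<alpha>_def)
    moreover have "(f (q k) - f (q k')) \<bullet> f (e i) = (real (k i) - real (k' i)) * (3 * \<rho> * \<alpha> i)"
      unfolding inner_diff_left q_def singular_basis_inner_comb[OF f(1) e i(1)]
      using pos[OF i(1)] by (simp add: \<alpha>_def power2_eq_square algebra_simps)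
    moreover have "1 * (3 * \<rho> * \<alpha> i) \<le> \<bar>real (k i) - real (k' i)\<bar> * (3 * \<rho> * \<alpha> i)"
      using i(2) pos[OF i(1)] rho by (intro mult_right_mono) auto
    moreover have "\<bar>(real (k i) - real (k' i)) * (3 * \<rho> * \<alpha> i)\<bar>
        = \<bar>real (k i) - real (k' i)\<bar> * (3 * \<rho> * \<alpha> i)"
      using pos[OF i(1)] rho by (simp add: abs_mult)
    ultimately have "3 * \<rho> * \<alpha> i \<le> 2 * \<rho> * \<alpha> i"
      by linarith
    then show False using pos[OF i(1)] rho by simp
  qed
  then have "card (PiE {..<CARD('n)} K) \<le> card X"
    using h(1) X(1) by (intro card_inj_on_le) auto
  moreover have "(\<Prod>i<CARD('n). max 1 (\<alpha> i / c)) \<le> (\<Prod>i<CARD('n). real (card (K i)))"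
  proof (intro prod_mono conjI)
    fix i assume i: "i \<in> {..<CARD('n)}"
    have "real (card (K i)) = real (nat \<lfloor>\<alpha> i / c\<rfloor>) + 1" by (simp add: K_def)
    also have "\<dots> = of_int \<lfloor>\<alpha> i / c\<rfloor> + 1" using pos[of i] c i by (simp add: of_nat_nat)
    finally show "max 1 (\<alpha> i / c) \<le> real (card (K i))"
      using pos[of i] c i by (intro max.boundedI) (simp, linarith)
  qed simp
  moreover have "(\<Prod>i<CARD('n). real (card (K i))) = real (card (PiE {..<CARD('n)} K))"
    by (simp add: card_PiE)
  ultimately have "(\<Prod>i<CARD('n). max 1 (\<alpha> i / c)) \<le> real (card X)" by linarith
  then show ?thesis by (simp only: \<alpha>_def c_def)
qed

text \<open>\<open>svf s f\<close> is the product of the singular values with exponents \<open>sv_exponent N s\<close>; the second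
  summand accounts for the convention beyond \<open>s = N\<close>.\<close>

definition sv_exponent :: "nat \<Rightarrow> real \<Rightarrow> nat \<Rightarrow> real" where
  "sv_exponent N s i = max 0 (min 1 (s - real i)) + max 0 ((s - real N) / real N)"

section \<open>Exponents and the product formula\<close>

lemma sv_exponent_mono: "s \<le> t \<Longrightarrow> sv_exponent N s i \<le> sv_exponent N t i"
  unfolding sv_exponent_def by (intro add_mono max.mono min.mono divide_right_mono) auto

lemma sum_clamp: "0 \<le> s \<Longrightarrow> (\<Sum>i<n. max 0 (min 1 (s - real i))) = min s (real n)"
  by (induction n) (auto simp: min_def max_def)

text \<open>Homogeneity: exponents of total \<open>s\<close> turn a common factor of all singular
  values into its \<open>s\<close>-th power, also beyond the dimension.\<close>

lemma sum_sv_exponent: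
  assumes "0 \<le> s" "N > 0"
  shows "(\<Sum>i<N. sv_exponent N s i) = s"
proof -
  have "(\<Sum>i<N. sv_exponent N s i) = min s (real N) + real N * max 0 ((s - real N) / real N)"
    by (simp add: sv_exponent_def sum.distrib sum_clamp[OF assms(1)])
  also have "\<dots> = s" using assms(2) by (auto simp: min_def max_def divide_simps)
  finally show ?thesis .
qed

lemma sv_exponent_le:
  assumes "s \<le> real N"
  shows "sv_exponent N s i = max 0 (min 1 (s - real i))"
proof -
  have "(s - real N) / real N \<le> 0" using assms by (simp add: divide_nonpos_nonneg)
  then show ?thesis by (simp add: sv_exponent_def)
qed

lemma svf_eq_prod:
  fixes f :: "real^'n \<Rightarrow> real^'n"
  assumes "linear f" "inj f" "0 \<le> s"
  shows "svf s f = (\<Prod>i<CARD('n). sv f (Suc i) powr sv_exponent CARD('n) s i)"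
proof -
  define N where "N = CARD('n)"
  have N: "N > 0" by (simp add: N_def)
  have pos: "sv f (Suc i) > 0" if "i < N" for i using sv_pos[OF assms(1,2)] that by (simp add: N_def)
  consider "s = 0" | "0 < s" "s \<le> real N" | "s > real N" using assms(3) by linarith
  then have "svf s f = (\<Prod>i<N. sv f (Suc i) powr sv_exponent N s i)"
  proof cases
    case 1
    have "sv f (Suc i) powr sv_exponent N s i = 1" if "i < N" for i
      using pos[OF that] 1 by (simp add: sv_exponent_le)
    then show ?thesis using 1 by (simp add: svf_def)
  next
    case 2
    \<comment> \<open>Counted from 0: the exponents are 1 below \<open>l\<close>,
      \<open>s - real l\<close> at \<open>l\<close> and 0 above.\<close>
    define l where "l = nat \<lceil>s\<rceil> - 1"
    have l1: "nat \<lceil>s\<rceil> = Suc l" using 2 unfolding l_def by simp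
    have l: "real l < s" "s \<le> real l + 1" using 2 l1 by linarith+
    have lN: "l < N" using l 2 by linarith
    let ?t = "\<lambda>i. sv f (Suc i) powr sv_exponent N s i"
    have "(\<Prod>i<N. ?t i) = (\<Prod>i<l. ?t i) * ?t l * (\<Prod>i\<in>{Suc l..<N}. ?t i)"
      using prod.atLeastLessThan_concat[of 0 "Suc l" N ?t] lN by (simp add: lessThan_atLeast0)
    also have "(\<Prod>i\<in>{Suc l..<N}. ?t i) = 1"
    proof (intro prod.neutral ballI)
      fix i assume i: "i \<in> {Suc l..<N}"
      then have "s - real i \<le> 0" using l by simp
      then have "sv_exponent N s i = 0" by (simp add: sv_exponent_le[OF 2(2)])
      then show "?t i = 1" using pos[of i] i by simp
    qed
    also have "(\<Prod>i<l. ?t i) = (\<Prod>i<l. sv f (Suc i))"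
    proof (intro prod.cong refl)
      fix i assume i: "i \<in> {..<l}"
      then have "real i + 1 \<le> real l" by simp
      then have "s - real i \<ge> 1" using l by linarith
      then have "sv_exponent N s i = 1" by (simp add: sv_exponent_le[OF 2(2)])
      then show "?t i = sv f (Suc i)" using pos[of i] i lN by simp
    qed
    also have "\<dots> = (\<Prod>j=1..<Suc l. sv f j)"
      by (rule prod.reindex_bij_witness[of _ "\<lambda>j. j - 1" Suc]) auto
    also have "?t l = sv f (Suc l) powr (s - real (Suc l) + 1)"
      using l by (simp add: sv_exponent_le[OF 2(2)])
    finally show ?thesis using 2 unfolding svf_def l1 by (simp add: N_def)
  next
    case 3
    have "(\<Prod>i<N. sv f (Suc i) powr sv_exponent N s i) = (\<Prod>i<N. sv f (Suc i) powr (s / real N))"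
      using 3 N by (intro prod.cong refl) (simp add: sv_exponent_def min_def max_def divide_simps)
    also have "\<dots> = (\<Prod>i<N. sv f (Suc i)) powr (s / real N)"
      by (rule prod_powr_distrib[symmetric])
    also have "(\<Prod>i<N. sv f (Suc i)) = (\<Prod>j=1..N. sv f j)"
      by (rule prod.reindex_bij_witness[of _ "\<lambda>j. j - 1" Suc]) auto
    finally show ?thesis using 3 assms(3) N by (simp add: svf_def N_def)
  qed
  then show ?thesis by (simp add: N_def)
qed

lemma svf_pos:
  fixes f :: "real^'n \<Rightarrow> real^'n"
  assumes "linear f" "inj f" "0 \<le> s"
  shows "0 < svf s f"
  unfolding svf_eq_prod[OF assms]
proof (intro prod_pos)
  show "0 < sv f (Suc i) powr sv_exponent CARD('n) s i" if "i \<in> {..<CARD('n)}" for i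
    using sv_pos[OF assms(1,2), of i] that by simp
qed

text \<open>Raising the parameter raises every exponent by some \<open>d i \<ge> 0\<close>, in total
  by \<open>t - s\<close>, so each factor is compared with a power of \<open>a\<close> or
  \<open>b\<close>. This is the source of both growth bounds of the pressure.\<close>

lemma svf_ratio:
  fixes f :: "real^'n \<Rightarrow> real^'n"
  assumes f: "linear f" "inj f" and "0 \<le> s" "s \<le> t"
    and ab: "0 < b" "\<And>i. i < CARD('n) \<Longrightarrow> b \<le> sv f (Suc i)" "\<And>i. i < CARD('n) \<Longrightarrow> sv f (Suc i) \<le> a"
  shows "svf s f * b powr (t - s) \<le> svf t f" "svf t f \<le> svf s f * a powr (t - s)"
proof -
  define d where "d i = sv_exponent CARD('n) t i - sv_exponent CARD('n) s i" for i
  have d: "d i \<ge> 0" for i using sv_exponent_mono[OF assms(4)] by (simp add: d_def)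
  have dsum: "(\<Sum>i<CARD('n). d i) = t - s"
    using assms(3,4) by (simp add: d_def sum_subtractf sum_sv_exponent)
  have pos: "sv f (Suc i) > 0" if "i < CARD('n)" for i using sv_pos[OF f that] .
  have "a > 0" using ab(1) ab(2)[of 0] ab(3)[of 0] by (simp add: zero_less_card_finite)
  have "svf t f = (\<Prod>i<CARD('n). sv f (Suc i) powr sv_exponent CARD('n) s i * sv f (Suc i) powr d i)"
    using assms(3,4) by (simp add: svf_eq_prod[OF f] d_def flip: powr_add)
  then have eq: "svf t f = svf s f * (\<Prod>i<CARD('n). sv f (Suc i) powr d i)"
    using assms(3) by (simp add: svf_eq_prod[OF f] prod.distrib)
  have "b powr (t - s) = (\<Prod>i<CARD('n). b powr d i)"
    using ab(1) by (simp add: powr_sum flip: dsum)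
  also have "\<dots> \<le> (\<Prod>i<CARD('n). sv f (Suc i) powr d i)"
    using ab d by (intro prod_mono) (auto intro!: powr_mono2)
  finally show "svf s f * b powr (t - s) \<le> svf t f"
    unfolding eq using svf_pos[OF f assms(3)] by (intro mult_left_mono) auto
  have "(\<Prod>i<CARD('n). sv f (Suc i) powr d i) \<le> (\<Prod>i<CARD('n). a powr d i)"
    using ab(3) d pos by (intro prod_mono conjI powr_mono2) (simp_all add: less_imp_le)
  also have "\<dots> = a powr (t - s)"
    using \<open>a > 0\<close> by (simp add: powr_sum flip: dsum)
  finally show "svf t f \<le> svf s f * a powr (t - s)"
    unfolding eq using svf_pos[OF f assms(3)] by (intro mult_left_mono) auto
qed

section \<open>Singular value function against covering numbers\<close>

text \<open>Up to the dimension all exponents lie between 0 and 1, so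
  \<open>y powr t i \<le> max 1 y\<close>; the product of these maxima is the packing bound.\<close>

lemma svf_le_cover:
  fixes f :: "real^'n \<Rightarrow> real^'n"
  assumes f: "linear f" "inj f" and s: "0 \<le> s" "s \<le> real CARD('n)" and rho: "\<rho> > 0"
    and X: "finite X" "f ` cball 0 1 \<subseteq> (\<Union>x\<in>X. cball x \<rho>)"
  shows "svf s f \<le> (3 * real CARD('n) * \<rho>) powr s * real (card X)"
proof -
  define c where "c = 3 * real CARD('n) * \<rho>"
  define t where "t = sv_exponent CARD('n) s"
  have c: "c > 0" using rho by (simp add: c_def zero_less_card_finite)
  have t: "t i \<ge> 0" "t i \<le> 1" for i by (simp_all add: t_def sv_exponent_le[OF s(2)])
  have tsum: "(\<Sum>i<CARD('n). t i) = s" using s by (simp add: t_def sum_sv_exponent)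
  have pos: "sv f (Suc i) > 0" if "i < CARD('n)" for i using sv_pos[OF f that] .
  have "svf s f = (\<Prod>i<CARD('n). c powr t i * (sv f (Suc i) / c) powr t i)"
    unfolding svf_eq_prod[OF f s(1)] t_def[symmetric]
    using c pos by (intro prod.cong refl) (simp add: powr_mult[symmetric] less_imp_le)
  also have "\<dots> = c powr s * (\<Prod>i<CARD('n). (sv f (Suc i) / c) powr t i)"
    using c by (simp add: prod.distrib powr_sum flip: tsum)
  also have "\<dots> \<le> c powr s * (\<Prod>i<CARD('n). max 1 (sv f (Suc i) / c))"
  proof (intro mult_left_mono prod_mono conjI)
    fix i assume i: "i \<in> {..<CARD('n)}"
    define y where "y = sv f (Suc i) / c"
    have "y > 0" using c pos i by (simp add: y_def)
    have "y powr t i \<le> (max 1 y) powr t i" using \<open>y > 0\<close> t by (intro powr_mono2) auto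
    also have "\<dots> \<le> (max 1 y) powr 1" using t by (intro powr_mono) auto
    finally show "(sv f (Suc i) / c) powr t i \<le> max 1 (sv f (Suc i) / c)" by (simp add: y_def)
  qed auto
  also have "\<dots> \<le> c powr s * real (card X)"
    using ellipsoid_packing[OF f rho X] by (intro mult_left_mono) (auto simp: c_def)
  finally show ?thesis by (simp add: c_def)
qed

text \<open>At this radius the covering count and \<open>svf\<close> match: singular values before
  position \<open>nat \<lceil>s\<rceil>\<close> are at least \<open>\<rho>\<close> and have exponent
  1, later ones are at most \<open>\<rho>\<close> and have exponent 0. Hence each
  \<open>max 1 (sv f (Suc i) / \<rho>)\<close> equals the quotient raised to its exponent.\<close>

lemma cover_le_svf:
  fixes f :: "real^'n \<Rightarrow> real^'n"
  assumes f: "linear f" "inj f" and s: "0 < s" "s \<le> real CARD('n)"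
  defines "\<rho> \<equiv> sv f (nat \<lceil>s\<rceil>)"
  obtains X where "finite X" "real (card X) * \<rho> powr s \<le> 4 ^ CARD('n) * svf s f"
    "f ` cball 0 1 \<subseteq> (\<Union>x\<in>X. cball x (real CARD('n) * \<rho>))"
proof -
  define l where "l = nat \<lceil>s\<rceil> - 1"
  have l1: "nat \<lceil>s\<rceil> = Suc l" using s unfolding l_def by simp
  have l: "real l < s" "s \<le> real l + 1" using s l1 by linarith+
  have lN: "l < CARD('n)" using l s by linarith
  have rho: "\<rho> = sv f (Suc l)" by (simp add: \<rho>_def l1)
  have pos: "sv f (Suc i) > 0" if "i < CARD('n)" for i using sv_pos[OF f that] .
  have rho0: "\<rho> > 0" using pos[OF lN] rho by simp
  obtain X where X: "finite X" "real (card X) \<le> (\<Prod>i<CARD('n). 4 * max 1 (sv f (Suc i) / \<rho>))"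
    "f ` cball 0 1 \<subseteq> (\<Union>x\<in>X. cball x (real CARD('n) * \<rho>))"
    by (rule ellipsoid_cover[OF f rho0])
  define t where "t = sv_exponent CARD('n) s"
  have t: "t i = max 0 (min 1 (s - real i))" for i by (simp add: t_def sv_exponent_le[OF s(2)])
  have tsum: "(\<Sum>i<CARD('n). t i) = s" using s by (simp add: t_def sum_sv_exponent)
  have "max 1 (sv f (Suc i) / \<rho>) = (sv f (Suc i) / \<rho>) powr t i" if i: "i < CARD('n)" for i
  proof -
    consider "i < l" | "i = l" | "l < i" by linarith
    then show ?thesis
    proof cases
      case 1
      then have "sv f (Suc i) / \<rho> \<ge> 1" using sv_antimono[OF f(1), of i l] lN rho rho0 by simp
      moreover have "t i = 1" using 1 l by (simp add: t)
      ultimately show ?thesis by (metis max_absorb2 powr_one zero_le_one order_trans)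
    next
      case 2 then show ?thesis using rho0 rho by simp
    next
      case 3
      then have "sv f (Suc i) / \<rho> \<le> 1" "sv f (Suc i) / \<rho> > 0"
        using sv_antimono[OF f(1), of l i] i rho rho0 pos by auto
      moreover have "t i = 0" using 3 l by (simp add: t)
      ultimately show ?thesis by (metis max_absorb1 powr_zero_eq_one less_irrefl)
    qed
  qed
  then have "(\<Prod>i<CARD('n). 4 * max 1 (sv f (Suc i) / \<rho>)) * \<rho> powr s
      = (\<Prod>i<CARD('n). 4 * (sv f (Suc i) / \<rho>) powr t i) * (\<Prod>i<CARD('n). \<rho> powr t i)"
    using rho0 by (simp add: powr_sum flip: tsum)
  also have "\<dots> = 4 ^ CARD('n) * (\<Prod>i<CARD('n). (sv f (Suc i) / \<rho>) powr t i * \<rho> powr t i)"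
    by (simp add: prod.distrib)
  also have "(\<Prod>i<CARD('n). (sv f (Suc i) / \<rho>) powr t i * \<rho> powr t i) = svf s f"
    unfolding svf_eq_prod[OF f less_imp_le[OF s(1)]] t_def[symmetric]
    using rho0 pos by (intro prod.cong refl) (simp add: powr_mult[symmetric] less_imp_le)
  finally have eq: "(\<Prod>i<CARD('n). 4 * max 1 (sv f (Suc i) / \<rho>)) * \<rho> powr s = 4 ^ CARD('n) * svf s f" .
  have "real (card X) * \<rho> powr s \<le> 4 ^ CARD('n) * svf s f"
    using mult_right_mono[OF X(2), of "\<rho> powr s"] by (simp add: eq)
  then show ?thesis using X that by blast
qed

text \<open>The images of the unit ball under \<open>g\<close> and \<open>f\<close> are covered by balls whose radii are singular
  values; composing the two coverings bounds the covering number of its image under \<open>f \<circ> g\<close>.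
  This replaces exterior powers.\<close>

lemma svf_compose_le_dim:
  fixes f g :: "real^'n \<Rightarrow> real^'n"
  assumes f: "linear f" "inj f" and g: "linear g" "inj g" and s: "0 \<le> s" "s \<le> real CARD('n)"
  shows "svf s (f \<circ> g) \<le> (16 ^ CARD('n) * (3 * real CARD('n) ^ 3) powr s) * (svf s f * svf s g)"
proof (cases "s = 0")
  case True
  then show ?thesis by (simp add: svf_def one_le_power)
next
  case False
  with s have s0: "0 < s" by simp
  have fg: "linear (f \<circ> g)" "inj (f \<circ> g)"
    using linear_compose[OF g(1) f(1)] inj_compose[OF f(2) g(2)] by auto
  define N where "N = real CARD('n)"
  have N: "N > 0" by (simp add: N_def zero_less_card_finite)
  define l where "l = nat \<lceil>s\<rceil>"
  have l: "0 < l" "l - 1 < CARD('n)" using s0 s(2) unfolding l_def by linarith+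
  define \<rho> \<sigma> where "\<rho> = sv f l" and "\<sigma> = sv g l"
  have pos: "\<rho> > 0" "\<sigma> > 0" using sv_pos[OF f l(2)] sv_pos[OF g l(2)] l(1) by (simp_all add: \<rho>_def \<sigma>_def)
  obtain X where X: "finite X" "real (card X) * \<rho> powr s \<le> 4 ^ CARD('n) * svf s f"
    "f ` cball 0 1 \<subseteq> (\<Union>x\<in>X. cball x (N * \<rho>))"
    using cover_le_svf[OF f s0 s(2)] unfolding \<rho>_def l_def N_def by metis
  obtain Y where Y: "finite Y" "real (card Y) * \<sigma> powr s \<le> 4 ^ CARD('n) * svf s g"
    "g ` cball 0 1 \<subseteq> (\<Union>x\<in>Y. cball x (N * \<sigma>))"
    using cover_le_svf[OF g s0 s(2)] unfolding \<sigma>_def l_def N_def by metis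
  \<comment> \<open>\<open>f\<close> maps the ball of radius \<open>N * \<sigma>\<close> about
    \<open>y\<close> to a translate of \<open>N * \<sigma>\<close> times its image of the unit ball,
    so a scaled copy of \<open>X\<close> covers it. In the final constant, 16 collects the factors 4
    of both coverings, and \<open>3 * N ^ 3\<close> the factor \<open>3 * N\<close> of the packing
    bound and the factor \<open>N\<close> of each radius.\<close>
  define Z where "Z = (\<lambda>(x, y). (N * \<sigma>) *\<^sub>R x + f y) ` (X \<times> Y)"
  have "(f \<circ> g) ` cball 0 1 \<subseteq> (\<Union>z\<in>Z. cball z (N * \<sigma> * (N * \<rho>)))"
  proof
    fix u assume "u \<in> (f \<circ> g) ` cball 0 1"
    then obtain v where v: "v \<in> cball 0 1" "u = f (g v)" by auto
    then obtain y where y: "y \<in> Y" "dist y (g v) \<le> N * \<sigma>" using Y(3) by fastforce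
    define w where "w = (1 / (N * \<sigma>)) *\<^sub>R (g v - y)"
    have gv: "g v = (N * \<sigma>) *\<^sub>R w + y" using N pos by (simp add: w_def)
    have "norm w = dist y (g v) / (N * \<sigma>)" using N pos by (simp add: w_def dist_norm norm_minus_commute)
    then have "w \<in> cball 0 1" using y N pos by (simp add: divide_le_eq)
    then obtain x where x: "x \<in> X" "dist x (f w) \<le> N * \<rho>" using X(3) by fastforce
    have "u = (N * \<sigma>) *\<^sub>R f w + f y"
      using v(2) by (simp add: gv linear_add[OF f(1)] linear_scale[OF f(1)])
    then have "dist ((N * \<sigma>) *\<^sub>R x + f y) u = N * \<sigma> * dist x (f w)"
      using N pos by (simp add: dist_norm flip: scaleR_diff_right)
    then have "u \<in> cball ((N * \<sigma>) *\<^sub>R x + f y) (N * \<sigma> * (N * \<rho>))"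
      using x(2) N pos by (simp add: mult_left_mono)
    then show "u \<in> (\<Union>z\<in>Z. cball z (N * \<sigma> * (N * \<rho>)))"
      using x(1) y(1) by (auto simp: Z_def)
  qed
  moreover have "finite Z" using X(1) Y(1) by (simp add: Z_def)
  ultimately have "svf s (f \<circ> g) \<le> (3 * N * (N * \<sigma> * (N * \<rho>))) powr s * real (card Z)"
    using svf_le_cover[OF fg s, of "N * \<sigma> * (N * \<rho>)" Z] N pos by (simp add: N_def)
  also have "\<dots> \<le> (3 * N * (N * \<sigma> * (N * \<rho>))) powr s * (real (card X) * real (card Y))"
    using card_image_le[of "X \<times> Y" "\<lambda>(x, y). (N * \<sigma>) *\<^sub>R x + f y"] X(1) Y(1)
    by (intro mult_left_mono) (auto simp: Z_def card_cartesian_product simp flip: of_nat_mult)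
  also have "3 * N * (N * \<sigma> * (N * \<rho>)) = 3 * N ^ 3 * (\<rho> * \<sigma>)"
    by (simp add: power3_eq_cube)
  also have "(3 * N ^ 3 * (\<rho> * \<sigma>)) powr s * (real (card X) * real (card Y))
      = (3 * N ^ 3) powr s * ((real (card X) * \<rho> powr s) * (real (card Y) * \<sigma> powr s))"
    using N pos by (simp add: powr_mult mult_ac)
  also have "\<dots> \<le> (3 * N ^ 3) powr s * ((4 ^ CARD('n) * svf s f) * (4 ^ CARD('n) * svf s g))"
    using svf_pos[OF f s(1)] by (intro mult_left_mono[OF mult_mono[OF X(2) Y(2)]]) auto
  also have "\<dots> = (16 ^ CARD('n) * (3 * N ^ 3) powr s) * (svf s f * svf s g)"
    by (simp add: mult_ac flip: power_mult_distrib)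
  finally show ?thesis unfolding N_def .
qed

lemma svf_eq_powr:
  fixes f :: "real^'n \<Rightarrow> real^'n"
  assumes "s > real CARD('n)" "linear f" "inj f"
  shows "svf s f = (svf (real CARD('n)) f) powr (s / real CARD('n))"
proof -
  have l: "nat \<lceil>real CARD('n)\<rceil> = CARD('n)" by simp
  have "{1..CARD('n)} = insert CARD('n) {1..<CARD('n)}"
    using zero_less_card_finite[where 'a='n] by auto
  moreover have "sv f CARD('n) > 0"
    using sv_pos[OF assms(2,3), of "CARD('n) - 1"] zero_less_card_finite[where 'a='n] by simp
  ultimately show ?thesis using assms(1) unfolding svf_def l by (simp add: Let_def mult.commute)
qed

text \<open>The constant is uniform in the maps, which keeps the error in the superadditivity of
  \<open>log_ratio\<close> bounded. Beyond the dimension, \<open>svf\<close> is a power of its value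
  at the dimension, so that one inequality is raised to the power \<open>s / N\<close>.\<close>

lemma svf_compose_le:
  assumes "0 \<le> s"
  obtains C where "C \<ge> 1"
    "\<And>f g :: real^'n \<Rightarrow> real^'n. linear f \<Longrightarrow> inj f \<Longrightarrow> linear g \<Longrightarrow> inj g \<Longrightarrow>
       svf s (f \<circ> g) \<le> C * (svf s f * svf s g)"
proof -
  define N where "N = real CARD('n)"
  have N: "N \<ge> 1" unfolding N_def using zero_less_card_finite[where 'a='n] by linarith
  define C where "C s = (16 ^ CARD('n) * (3 * N ^ 3) powr s)" for s
  have C1: "C s \<ge> 1" if "s \<ge> 0" for s
  proof -
    have "3 * N ^ 3 \<ge> 1" using one_le_power[OF N, of 3] by linarith
    then have "(3 * N ^ 3) powr s \<ge> 1" using that by (rule ge_one_powr_ge_zero)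
    moreover have "(16::real) ^ CARD('n) \<ge> 1" by (rule one_le_power) simp
    ultimately show ?thesis
      using mult_mono[of 1 "(16::real) ^ CARD('n)" 1 "(3 * N ^ 3) powr s"] by (simp add: C_def)
  qed
  show thesis
  proof (cases "s \<le> N")
    case True
    show ?thesis
      using svf_compose_le_dim[where 'n='n, OF _ _ _ _ assms] True C1[OF assms]
      by (intro that[of "C s"]) (auto simp: C_def N_def)
  next
    case False
    show ?thesis
    proof (rule that[of "C N powr (s / N)"])
      show "1 \<le> C N powr (s / N)" using C1[of N] N assms by (intro ge_one_powr_ge_zero) auto
      fix f g :: "real^'n \<Rightarrow> real^'n"
      assume f: "linear f" "inj f" and g: "linear g" "inj g"
      have fg: "linear (f \<circ> g)" "inj (f \<circ> g)"
        using linear_compose[OF g(1) f(1)] inj_compose[OF f(2) g(2)] by auto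
      have sN: "s > real CARD('n)" using False by (simp add: N_def)
      have N0: "0 \<le> real CARD('n)" by simp
      have "svf N (f \<circ> g) powr (s / N) \<le> (C N * (svf N f * svf N g)) powr (s / N)"
        using svf_compose_le_dim[OF f g N0] svf_pos[OF fg N0] N assms
        by (intro powr_mono2) (auto simp: C_def N_def)
      also have "\<dots> = C N powr (s / N) * (svf N f powr (s / N) * svf N g powr (s / N))"
        using svf_pos[OF f N0] svf_pos[OF g N0] C1[of N] N by (simp add: powr_mult N_def)
      finally show "svf s (f \<circ> g) \<le> C N powr (s / N) * (svf s f * svf s g)"
        using svf_eq_powr[OF sN] f g fg by (simp add: N_def)
    qed
  qed
qed

section \<open>Pressure\<close>

lemma superadditive_mult:
  fixes x :: "nat \<Rightarrow> real"
  assumes "\<And>j k. x j + x k \<le> x (j + k)"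
  shows "real q * x k + x r \<le> x (q * k + r)"
proof (induction q)
  case (Suc q)
  have "x k + x (q * k + r) \<le> x (Suc q * k + r)"
    using assms[of k "q * k + r"] by (simp add: algebra_simps)
  with Suc show ?case by (simp add: algebra_simps)
qed simp

lemma fekete_superadditive:
  fixes x :: "nat \<Rightarrow> real"
  assumes super: "\<And>j k. x j + x k \<le> x (j + k)" and bd: "\<And>k. x k \<le> B * real k"
  shows "convergent (\<lambda>k. x k / real k)"
proof -
  define S where "S = (SUP k\<in>{1..}. x k / real k)"
  have bdd: "bdd_above ((\<lambda>k. x k / real k) ` {1..})"
    using bd by (intro bdd_aboveI[of _ B]) (auto simp: divide_le_eq)
  have up: "x k / real k \<le> S" if "k \<ge> 1" for k
    unfolding S_def using bdd that by (intro cSUP_upper) auto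
  have "(\<lambda>k. x k / real k) \<longlonglongrightarrow> S"
  proof (rule LIMSEQ_I)
    fix \<epsilon> :: real assume e: "\<epsilon> > 0"
    then obtain k where k: "k \<ge> 1" "S - \<epsilon> / 2 < x k / real k"
      using less_cSUP_iff[OF _ bdd, of "S - \<epsilon> / 2"] by (auto simp: S_def)
    define z where "z = x k / real k"
    have xk: "x k = real k * z" using k by (simp add: z_def)
    \<comment> \<open>Writing \<open>n = q * k + r\<close>, the remainder costs at most
      \<open>real r * z\<close> and \<open>x r\<close> compared with \<open>real n * z\<close>;
      \<open>D\<close> bounds both costs for all \<open>r < k\<close>.\<close>
    define D where "D = real k * \<bar>z\<bar> + (\<Sum>r<k. \<bar>x r\<bar>)"
    have low: "z - D / real n \<le> x n / real n" if n: "n \<ge> 1" for n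
    proof -
      define q r where "q = n div k" and "r = n mod k"
      have nqr: "n = q * k + r" and r: "r < k" using k by (auto simp: q_def r_def)
      have "real q * x k = real n * z - real r * z"
        by (simp add: nqr xk algebra_simps)
      moreover have "real r * z \<le> real r * \<bar>z\<bar>"
        by (intro mult_left_mono) auto
      moreover have "real r * \<bar>z\<bar> \<le> real k * \<bar>z\<bar>"
        using r by (intro mult_right_mono) auto
      moreover have "\<bar>x r\<bar> \<le> (\<Sum>r<k. \<bar>x r\<bar>)" using r by (intro member_le_sum) auto
      moreover have "real q * x k + x r \<le> x n"
        unfolding nqr by (rule superadditive_mult[OF super])
      ultimately have "real n * z - D \<le> x n" unfolding D_def by linarith
      then have "(real n * z - D) / real n \<le> x n / real n"
        by (rule divide_right_mono) simp
      then show ?thesis using n by (simp add: diff_divide_distrib)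
    qed
    have "(\<lambda>n. D / real n) \<longlonglongrightarrow> 0" by (rule lim_const_over_n)
    then have "eventually (\<lambda>n. D / real n < \<epsilon> / 2) sequentially"
      by (rule order_tendstoD) (use e in simp)
    then obtain n0 where n0: "\<And>n. n \<ge> n0 \<Longrightarrow> D / real n < \<epsilon> / 2"
      by (auto simp: eventually_sequentially)
    show "\<exists>n0. \<forall>n\<ge>n0. norm (x n / real n - S) < \<epsilon>"
    proof (intro exI[of _ "max 1 n0"] allI impI)
      fix n assume "max 1 n0 \<le> n"
      then have "n \<ge> 1" "n \<ge> n0" by auto
      then show "norm (x n / real n - S) < \<epsilon>"
        using low[of n] up[of n] n0[of n] k(2) e unfolding real_norm_def z_def by linarith
    qed
  qed
  then show ?thesis by (auto simp: convergent_def)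
qed

section \<open>Words, their maps and their weights\<close>

lemma finite_words: "finite (words m k)"
  unfolding words_def by (rule finite_lists_length_eq) simp

lemma words_0 [simp]: "words m 0 = {[]}"
  by (auto simp: words_def)

lemma words_append: "v \<in> words m j \<Longrightarrow> w \<in> words m k \<Longrightarrow> v @ w \<in> words m (j + k)"
  by (auto simp: words_def)

lemma sum_words_add:
  "(\<Sum>w\<in>words m (j + k). F w) = (\<Sum>v\<in>words m j. \<Sum>w\<in>words m k. F (v @ w))"
  unfolding sum.cartesian_product
  by (rule sum.reindex_bij_witness[of _ "\<lambda>(v, w). v @ w" "\<lambda>w. (take j w, drop j w)"])
     (auto simp: words_def dest: in_set_takeD in_set_dropD)

lemma sum_words_1: "(\<Sum>w\<in>words m (Suc 0). F w) = (\<Sum>i=1..m. F [i])"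
  by (rule sum.reindex_bij_witness[of _ "\<lambda>i. [i]" hd]) (auto simp: words_def length_Suc_conv)

lemma word_map_Nil [simp]: "word_map T [] = id"
  and word_map_Cons [simp]: "word_map T (i # w) = T i \<circ> word_map T w"
  by (simp_all add: word_map_def)

lemma word_map_append: "word_map T (v @ w) = word_map T v \<circ> word_map T w"
  by (induction v) (auto simp: o_assoc)

text \<open>\<open>a\<close> and \<open>b\<close> express contraction and invertibility as rates: a
  word of length \<open>k\<close> changes norms by a factor between \<open>b ^ k\<close> and
  \<open>a ^ k\<close>. With weights \<open>p\<close> in place of a measure on sequences, the
  pressure is a matter of finite sums.\<close>

locale linear_ifs =
  fixes T :: "nat \<Rightarrow> real^'n \<Rightarrow> real^'n" and m :: nat and p :: "nat \<Rightarrow> real" and a b :: real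
  assumes m2: "2 \<le> m"
    and linear_T: "\<And>i. i \<in> {1..m} \<Longrightarrow> linear (T i)"
    and norm_T_le: "\<And>i v. i \<in> {1..m} \<Longrightarrow> norm (T i v) \<le> a * norm v"
    and norm_T_ge: "\<And>i v. i \<in> {1..m} \<Longrightarrow> b * norm v \<le> norm (T i v)"
    and b0: "0 < b" and a1: "a < 1"
    and p_pos: "\<And>i. i \<in> {1..m} \<Longrightarrow> 0 < p i" and sum_p: "(\<Sum>i=1..m. p i) = 1"
begin

lemma b_le_a: "b \<le> a"
proof -
  obtain x :: "real^'n" where "norm x = 1" using vector_choose_size[of 1] by auto
  with norm_T_le[of 1 x] norm_T_ge[of 1 x] m2 show ?thesis by simp
qed

lemma a0: "0 < a" using b0 b_le_a by simp

lemma b1: "b < 1" using a1 b_le_a by simp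

abbreviation Tw :: "nat list \<Rightarrow> real^'n \<Rightarrow> real^'n" where "Tw \<equiv> word_map T"

definition pw :: "nat list \<Rightarrow> real" where "pw w = prod_list (map p w)"

lemma pw_append: "pw (v @ w) = pw v * pw w"
  by (simp add: pw_def)

lemma linear_Tw: "w \<in> words m k \<Longrightarrow> linear (Tw w)"
  unfolding words_def
proof (induction w arbitrary: k)
  case (Cons i w)
  then have i: "i \<in> {1..m}" and w: "w \<in> {w'. set w' \<subseteq> {1..m} \<and> length w' = length w}" by auto
  show ?case unfolding word_map_Cons by (rule linear_compose[OF Cons.IH[OF w] linear_T[OF i]])
qed (simp add: linear_id[unfolded id_def] id_def)

lemma norm_Tw_le: "w \<in> words m k \<Longrightarrow> norm (Tw w v) \<le> a ^ k * norm v"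
  unfolding words_def
proof (induction w arbitrary: k)
  case (Cons i w)
  then have "norm (T i (Tw w v)) \<le> a * norm (Tw w v)" using norm_T_le by simp
  also have "\<dots> \<le> a * (a ^ length w * norm v)" using Cons a0 by (intro mult_left_mono) auto
  finally show ?case using Cons.prems by (auto simp: mult_ac)
qed simp

lemma norm_Tw_ge: "w \<in> words m k \<Longrightarrow> b ^ k * norm v \<le> norm (Tw w v)"
  unfolding words_def
proof (induction w arbitrary: k)
  case (Cons i w)
  have "b * (b ^ length w * norm v) \<le> b * norm (Tw w v)" using Cons b0 by (intro mult_left_mono) auto
  also have "\<dots> \<le> norm (T i (Tw w v))" using norm_T_ge Cons.prems by simp
  finally show ?case using Cons.prems by (auto simp: mult_ac)
qed simp

lemma inj_Tw: "w \<in> words m k \<Longrightarrow> inj (Tw w)"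
proof -
  assume w: "w \<in> words m k"
  have "v = 0" if "Tw w v = 0" for v
  proof -
    have "b ^ k * norm v \<le> 0" using norm_Tw_ge[OF w, of v] that by simp
    then show ?thesis using zero_less_power[OF b0, of k] by (auto simp: mult_le_0_iff)
  qed
  then show ?thesis using linear_injective_0[OF linear_Tw[OF w]] by blast
qed

lemma pw_pos: "w \<in> words m k \<Longrightarrow> 0 < pw w"
  unfolding words_def pw_def by (induction w arbitrary: k) (auto simp: p_pos)

lemma sum_pw: "(\<Sum>w\<in>words m k. pw w) = 1"
proof (induction k)
  case (Suc k)
  have "(\<Sum>w\<in>words m (Suc 0 + k). pw w) = (\<Sum>v\<in>words m (Suc 0). pw v) * (\<Sum>w\<in>words m k. pw w)"
    unfolding sum_words_add pw_append sum_product by simp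
  also have "(\<Sum>v\<in>words m (Suc 0). pw v) = 1" by (simp only: sum_words_1) (simp add: pw_def sum_p[unfolded One_nat_def])
  finally show ?case using Suc by simp
qed (simp add: pw_def)

text \<open>\<open>pw\<close> is multiplicative with total mass 1, so the two halves of a
  concatenation are independent and the mean of \<open>G v + H w\<close> splits.\<close>

lemma sum_pw_additive:
  assumes "\<And>v w. v \<in> words m j \<Longrightarrow> w \<in> words m k \<Longrightarrow> G v + H w \<le> F (v @ w)"
  shows "(\<Sum>v\<in>words m j. pw v * G v) + (\<Sum>w\<in>words m k. pw w * H w) \<le> (\<Sum>w\<in>words m (j + k). pw w * F w)"
proof -
  have "(\<Sum>v\<in>words m j. pw v * G v) + (\<Sum>w\<in>words m k. pw w * H w)
     = (\<Sum>v\<in>words m j. pw v * G v) * (\<Sum>w\<in>words m k. pw w)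
       + (\<Sum>v\<in>words m j. pw v) * (\<Sum>w\<in>words m k. pw w * H w)"
    by (simp add: sum_pw)
  also have "\<dots> = (\<Sum>v\<in>words m j. \<Sum>w\<in>words m k. pw (v @ w) * (G v + H w))"
    unfolding sum_product sum.distrib[symmetric] by (simp add: pw_append algebra_simps)
  also have "\<dots> \<le> (\<Sum>v\<in>words m j. \<Sum>w\<in>words m k. pw (v @ w) * F (v @ w))"
    using assms pw_pos[OF words_append] by (intro sum_mono mult_left_mono) (auto intro: less_imp_le)
  finally show ?thesis by (simp add: sum_words_add)
qed

section \<open>The pressure and its zero\<close>

definition log_ratio :: "real \<Rightarrow> nat list \<Rightarrow> real" where
  "log_ratio s w = ln (pw w) - ln (svf s (Tw w))"

definition mean_log_ratio :: "real \<Rightarrow> nat \<Rightarrow> real" where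
  "mean_log_ratio s k = (\<Sum>w\<in>words m k. pw w * log_ratio s w)"

text \<open>The pressure written through the weights alone; \<open>pressure_eq_P\<close> identifies
  it with \<open>pressure\<close> for \<open>s \<ge> 0\<close>.\<close>

definition P :: "real \<Rightarrow> real" where
  "P s = lim (\<lambda>k. mean_log_ratio s k / real k)"

lemma svf_Tw_pos: "w \<in> words m k \<Longrightarrow> 0 \<le> s \<Longrightarrow> 0 < svf s (Tw w)"
  using svf_pos linear_Tw inj_Tw by blast

lemma log_ratio_append:
  assumes "0 \<le> s"
  obtains C where "C \<ge> 1"
    "\<And>j k v w. v \<in> words m j \<Longrightarrow> w \<in> words m k \<Longrightarrow>
       log_ratio s v + log_ratio s w - ln C \<le> log_ratio s (v @ w)"
proof -
  obtain C where C: "C \<ge> 1"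
    "\<And>f g :: real^'n \<Rightarrow> real^'n. linear f \<Longrightarrow> inj f \<Longrightarrow> linear g \<Longrightarrow> inj g \<Longrightarrow>
       svf s (f \<circ> g) \<le> C * (svf s f * svf s g)"
    using svf_compose_le[OF assms, where 'n='n] by metis
  have "log_ratio s v + log_ratio s w - ln C \<le> log_ratio s (v @ w)"
    if v: "v \<in> words m j" and w: "w \<in> words m k" for j k v w
  proof -
    have pos: "0 < svf s (Tw v)" "0 < svf s (Tw w)" "0 < svf s (Tw (v @ w))" "0 < pw v" "0 < pw w"
      using svf_Tw_pos[OF _ assms] pw_pos v w words_append[OF v w] by blast+
    have "svf s (Tw (v @ w)) \<le> C * (svf s (Tw v) * svf s (Tw w))"
      unfolding word_map_append by (intro C(2) linear_Tw[OF v] linear_Tw[OF w] inj_Tw[OF v] inj_Tw[OF w])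
    then have "ln (svf s (Tw (v @ w))) \<le> ln (C * (svf s (Tw v) * svf s (Tw w)))"
      using pos C(1) by (intro ln_mono) auto
    also have "\<dots> = ln C + ln (svf s (Tw v)) + ln (svf s (Tw w))"
      using pos C(1) by (simp add: ln_mult)
    finally show ?thesis using pos by (simp add: log_ratio_def pw_append ln_mult)
  qed
  with C(1) show ?thesis using that by blast
qed

lemma log_svf_diff:
  assumes "0 \<le> s" "s \<le> t" and w: "w \<in> words m k"
  shows "(t - s) * (- ln a) * real k \<le> log_ratio t w - log_ratio s w"
    and "log_ratio t w - log_ratio s w \<le> (t - s) * (- ln b) * real k"
proof -
  note lin = linear_Tw[OF w] and inj = inj_Tw[OF w]
  have "svf s (Tw w) * (b ^ k) powr (t - s) \<le> svf t (Tw w)"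
    "svf t (Tw w) \<le> svf s (Tw w) * (a ^ k) powr (t - s)"
    using svf_ratio[OF lin inj assms(1,2), of "b ^ k" "a ^ k"] b0
      sv_lower[OF lin norm_Tw_ge[OF w]] sv_upper[OF lin norm_Tw_le[OF w]] by auto
  then have "ln (svf s (Tw w) * (b ^ k) powr (t - s)) \<le> ln (svf t (Tw w))"
    "ln (svf t (Tw w)) \<le> ln (svf s (Tw w) * (a ^ k) powr (t - s))"
    using svf_Tw_pos[OF w] assms(1,2) b0 by (auto intro!: ln_mono)
  then have "ln (svf s (Tw w)) + (t - s) * (real k * ln b) \<le> ln (svf t (Tw w))"
    "ln (svf t (Tw w)) \<le> ln (svf s (Tw w)) + (t - s) * (real k * ln a)"
    using svf_Tw_pos[OF w assms(1)] b0 a0 by (simp_all add: ln_mult ln_powr ln_realpow)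
  then show "(t - s) * (- ln a) * real k \<le> log_ratio t w - log_ratio s w"
    "log_ratio t w - log_ratio s w \<le> (t - s) * (- ln b) * real k"
    unfolding log_ratio_def by (simp_all add: algebra_simps)
qed

lemma log_ratio_0: "log_ratio 0 w = ln (pw w)"
  by (simp add: log_ratio_def svf_def)

lemma mean_log_ratio_diff:
  assumes "0 \<le> s" "s \<le> t"
  shows "(t - s) * (- ln a) * real k \<le> mean_log_ratio t k - mean_log_ratio s k"
    and "mean_log_ratio t k - mean_log_ratio s k \<le> (t - s) * (- ln b) * real k"
proof -
  have eq: "mean_log_ratio t k - mean_log_ratio s k
      = (\<Sum>w\<in>words m k. pw w * (log_ratio t w - log_ratio s w))"
    by (simp add: mean_log_ratio_def sum_subtractf right_diff_distrib)
  have c: "c = (\<Sum>w\<in>words m k. pw w * c)" for c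
    by (simp add: sum_pw flip: sum_distrib_right)
  show "(t - s) * (- ln a) * real k \<le> mean_log_ratio t k - mean_log_ratio s k"
    unfolding eq by (subst c) (intro sum_mono mult_left_mono log_svf_diff[OF assms] less_imp_le[OF pw_pos])
  show "mean_log_ratio t k - mean_log_ratio s k \<le> (t - s) * (- ln b) * real k"
    unfolding eq by (subst c) (intro sum_mono mult_left_mono log_svf_diff[OF assms] less_imp_le[OF pw_pos])
qed

text \<open>At \<open>s = 0\<close> the ratio is \<open>ln (pw w)\<close>, additive under
  concatenation; superadditivity of the means of this function and of its negative gives equality.
  The sum is minus the entropy of the weights.\<close>

lemma mean_log_ratio_0: "mean_log_ratio 0 k = real k * (\<Sum>i=1..m. p i * ln (p i))"
proof (induction k)
  case (Suc k)
  have "mean_log_ratio 0 (Suc 0) + mean_log_ratio 0 k \<le> mean_log_ratio 0 (Suc 0 + k)"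
    unfolding mean_log_ratio_def log_ratio_0
    using pw_pos[of _ "Suc 0"] pw_pos[of _ k]
    by (intro sum_pw_additive[where F = "\<lambda>w. ln (pw w)" and G = "\<lambda>w. ln (pw w)" and H = "\<lambda>w. ln (pw w)"])
      (simp add: pw_append ln_mult_pos)
  moreover have "(\<Sum>w\<in>words m (Suc 0). pw w * (- ln (pw w))) + (\<Sum>w\<in>words m k. pw w * (- ln (pw w)))
      \<le> (\<Sum>w\<in>words m (Suc 0 + k). pw w * (- ln (pw w)))"
    using pw_pos[of _ "Suc 0"] pw_pos[of _ k]
    by (intro sum_pw_additive[where F = "\<lambda>w. - ln (pw w)" and G = "\<lambda>w. - ln (pw w)" and H = "\<lambda>w. - ln (pw w)"])
      (simp add: pw_append ln_mult_pos)
  then have "mean_log_ratio 0 (Suc 0 + k) \<le> mean_log_ratio 0 (Suc 0) + mean_log_ratio 0 k"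
    by (simp add: mean_log_ratio_def log_ratio_0 sum_negf)
  moreover have "mean_log_ratio 0 (Suc 0) = (\<Sum>i=1..m. p i * ln (p i))"
    unfolding mean_log_ratio_def log_ratio_0 sum_words_1 by (simp add: pw_def)
  ultimately show ?case using Suc by (simp add: algebra_simps)
qed (simp add: mean_log_ratio_def log_ratio_0 pw_def)

lemma P_tendsto:
  assumes "0 \<le> s"
  shows "(\<lambda>k. mean_log_ratio s k / real k) \<longlonglongrightarrow> P s"
proof -
  obtain C where C: "C \<ge> 1"
    "\<And>j k v w. v \<in> words m j \<Longrightarrow> w \<in> words m k \<Longrightarrow>
       log_ratio s v + log_ratio s w - ln C \<le> log_ratio s (v @ w)"
    using log_ratio_append[OF assms] by metis
  \<comment> \<open>One \<open>ln C\<close> subtracted from every term makes superadditivity exact: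
    of the two copies on the left, one covers the error and one the copy on the right.\<close>
  define x where "x k = mean_log_ratio s k - ln C" for k
  have x: "x k = (\<Sum>w\<in>words m k. pw w * (log_ratio s w - ln C))" for k
    by (simp add: x_def mean_log_ratio_def right_diff_distrib sum_subtractf sum_pw flip: sum_distrib_right)
  have "x j + x k \<le> x (j + k)" for j k
    unfolding x using C(2)[of _ j _ k] by (intro sum_pw_additive) fastforce
  moreover have "x k \<le> (- s * ln b) * real k" for k
  proof -
    \<comment> \<open>The linear bound for Fekete's lemma: the mean is at most 0 at
      \<open>s = 0\<close> and grows in \<open>s\<close> at rate at most \<open>- ln b\<close> per
      letter.\<close>
    have "(\<Sum>i=1..m. p i * ln (p i)) \<le> 0"
    proof (intro sum_nonpos)
      fix i assume i: "i \<in> {1..m}"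
      have "p i \<le> 1" using member_le_sum[of i "{1..m}" p] i p_pos sum_p by (force intro: less_imp_le)
      then show "p i * ln (p i) \<le> 0" using p_pos[OF i] by (simp add: mult_nonneg_nonpos)
    qed
    then have "mean_log_ratio 0 k \<le> 0" by (simp add: mean_log_ratio_0 mult_nonneg_nonpos)
    then have "mean_log_ratio s k \<le> (- s * ln b) * real k"
      using mean_log_ratio_diff(2)[OF order_refl assms, of k] by simp
    then show ?thesis using ln_ge_zero[OF C(1)] unfolding x_def by linarith
  qed
  ultimately have "convergent (\<lambda>k. x k / real k)" by (rule fekete_superadditive)
  then obtain y where "(\<lambda>k. x k / real k) \<longlonglongrightarrow> y" by (auto simp: convergent_def)
  then have "(\<lambda>k. x k / real k + ln C / real k) \<longlonglongrightarrow> y + 0"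
    by (intro tendsto_add lim_const_over_n)
  then have "(\<lambda>k. mean_log_ratio s k / real k) \<longlonglongrightarrow> y"
    by (simp add: x_def add_divide_distrib[symmetric])
  then show ?thesis unfolding P_def by (simp add: limI)
qed

text \<open>The lower slope serves strict monotonicity, the upper one the continuity behind the
  intermediate value theorem.\<close>

lemma P_diff:
  assumes "0 \<le> s" "s \<le> t"
  shows "(t - s) * (- ln a) \<le> P t - P s" and "P t - P s \<le> (t - s) * (- ln b)"
proof -
  have lim: "(\<lambda>k. (mean_log_ratio t k - mean_log_ratio s k) / real k) \<longlonglongrightarrow> P t - P s"
    using tendsto_diff[OF P_tendsto[of t] P_tendsto[of s]] assms by (simp add: diff_divide_distrib)
  have "eventually (\<lambda>k. (t - s) * (- ln a) \<le> (mean_log_ratio t k - mean_log_ratio s k) / real k) sequentially"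
    using eventually_gt_at_top[of 0]
  proof eventually_elim
    case (elim k)
    then show ?case using mean_log_ratio_diff(1)[OF assms, of k] by (simp add: le_divide_eq)
  qed
  from tendsto_lowerbound[OF lim this] show "(t - s) * (- ln a) \<le> P t - P s" by simp
  have "eventually (\<lambda>k. (mean_log_ratio t k - mean_log_ratio s k) / real k \<le> (t - s) * (- ln b)) sequentially"
    using eventually_gt_at_top[of 0]
  proof eventually_elim
    case (elim k)
    then show ?case using mean_log_ratio_diff(2)[OF assms, of k] by (simp add: divide_le_eq)
  qed
  from tendsto_upperbound[OF lim this] show "P t - P s \<le> (t - s) * (- ln b)" by simp
qed

lemma P_strict_mono: "0 \<le> s \<Longrightarrow> s < t \<Longrightarrow> P s < P t"
  using P_diff(1)[of s t] ln_less_zero[OF a0 a1] mult_pos_pos[of "t - s" "- ln a"] by simp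

lemma P_0_neg: "P 0 < 0"
proof -
  have "(\<Sum>i=1..m. p i * ln (p i)) < 0"
  proof -
    have "p i < 1" if i: "i \<in> {1..m}" for i
    proof -
      \<comment> \<open>A second letter exists because \<open>m \<ge> 2\<close>; its positive weight
        keeps \<open>p i\<close> below 1.\<close>
      define j where "j = (if i = 1 then 2 else 1 :: nat)"
      have j: "j \<in> {1..m}" "i \<noteq> j" using m2 by (auto simp: j_def)
      have "sum p {i, j} \<le> sum p {1..m}"
        using i j p_pos by (intro sum_mono2) (auto intro: less_imp_le)
      then show ?thesis using sum_p p_pos[OF j(1)] j(2) by simp
    qed
    then have "p i * ln (p i) < 0" if "i \<in> {1..m}" for i
      using p_pos that by (simp add: mult_pos_neg ln_less_zero)
    then have "(\<Sum>i=1..m. p i * ln (p i)) < (\<Sum>i=1..m. 0)"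
      using m2 by (intro sum_strict_mono) auto
    then show ?thesis by simp
  qed
  moreover have "eventually (\<lambda>k. mean_log_ratio 0 k / real k = (\<Sum>i=1..m. p i * ln (p i))) sequentially"
    using eventually_gt_at_top[of "0 :: nat"] by eventually_elim (simp add: mean_log_ratio_0)
  then have "(\<lambda>k. mean_log_ratio 0 k / real k) \<longlonglongrightarrow> (\<Sum>i=1..m. p i * ln (p i))"
    by (rule tendsto_eventually)
  ultimately show ?thesis using P_tendsto[of 0] LIMSEQ_unique by force
qed

lemma P_zero_exists: "\<exists>!d. 0 < d \<and> P d = 0"
proof -
  \<comment> \<open>With slope at least \<open>- ln a\<close>, an interval of this length suffices
    for \<open>P\<close> to climb from \<open>P 0\<close> to a nonnegative value.\<close>
  define M where "M = P 0 / ln a"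
  have la: "ln a < 0" using ln_less_zero[OF a0 a1] .
  have M: "0 < M" using P_0_neg la by (simp add: M_def divide_neg_neg)
  have "P 0 + M * (- ln a) \<le> P M" using P_diff(1)[of 0 M] M by simp
  then have "0 \<le> P M" using la by (simp add: M_def)
  have "continuous_on {0..M} P"
  proof (rule lipschitz_on_continuous_on[OF lipschitz_onI])
    have lip: "\<bar>P y - P x\<bar> \<le> (- ln b) * \<bar>y - x\<bar>" if "0 \<le> x" "x \<le> y" for x y
      using P_diff[OF that] that mult_nonneg_nonneg[of "y - x" "- ln a"] la by (simp add: mult.commute)
    show "dist (P x) (P y) \<le> (- ln b) * dist x y" if "x \<in> {0..M}" "y \<in> {0..M}" for x y
      using lip[of x y] lip[of y x] that by (cases "x \<le> y") (simp_all add: dist_real_def abs_minus_commute)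
    show "0 \<le> - ln b" using ln_less_zero[OF b0 b1] by simp
  qed
  then obtain d where d: "0 \<le> d" "d \<le> M" "P d = 0"
    using IVT'[of P 0 0 M] P_0_neg \<open>0 \<le> P M\<close> M by auto
  have "d \<noteq> 0" using d P_0_neg by auto
  show ?thesis
  proof (rule ex1I[of _ d])
    show "0 < d \<and> P d = 0" using d \<open>d \<noteq> 0\<close> by simp
    show "y = d" if "0 < y \<and> P y = 0" for y
      using that d P_strict_mono[of y d] P_strict_mono[of d y] by (cases y d rule: linorder_cases) auto
  qed
qed

text \<open>An exponential moment of \<open>log_ratio\<close> below 1 at one word length propagates by
  superadditivity; this replaces the law of large numbers.\<close>

lemma exp_moment_decay:
  assumes "0 \<le> s" "0 < P s"
  obtains k \<theta> where "0 < k" "0 \<le> \<theta>" "\<theta> < 1"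
    "\<And>q. (\<Sum>w\<in>{w \<in> words m (q * k). pw w < svf s (Tw w)}. pw w) \<le> \<theta> ^ q"
proof -
  obtain C where C: "C \<ge> 1"
    "\<And>j k v w. v \<in> words m j \<Longrightarrow> w \<in> words m k \<Longrightarrow>
       log_ratio s v + log_ratio s w - ln C \<le> log_ratio s (v @ w)"
    using log_ratio_append[OF assms(1)] by metis
  \<comment> \<open>\<open>g\<close> is exactly superadditive. Some word length gives it positive
    mean, because \<open>ln C\<close> is negligible after division by the length.\<close>
  define g where "g w = log_ratio s w - ln C" for w
  have gg: "g v + g w \<le> g (v @ w)" if "v \<in> words m j" "w \<in> words m k" for v w j k
    using C(2)[OF that] by (simp add: g_def)
  have "(\<lambda>k. mean_log_ratio s k / real k - ln C / real k) \<longlonglongrightarrow> P s - 0"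
    by (intro tendsto_diff P_tendsto assms lim_const_over_n)
  then have "eventually (\<lambda>k. 0 < mean_log_ratio s k / real k - ln C / real k) sequentially"
    by (rule order_tendstoD) (use assms in simp)
  then have "eventually (\<lambda>k. 0 < k \<and> 0 < mean_log_ratio s k / real k - ln C / real k) sequentially"
    using eventually_gt_at_top[of 0] by eventually_elim auto
  then obtain k where k: "0 < k" "0 < mean_log_ratio s k / real k - ln C / real k"
    by (metis (mono_tags, lifting) eventually_sequentially order_refl)
  then have mk: "0 < mean_log_ratio s k - ln C"
    by (simp add: zero_less_divide_iff flip: diff_divide_distrib)
  \<comment> \<open>\<open>h 0 = 1\<close>, and the derivative at 0 is minus the mean of
    \<open>g\<close> over words of length \<open>k\<close>, hence negative; so
    \<open>h t < 1\<close> for some small \<open>t > 0\<close>.\<close>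
  define h where "h t = (\<Sum>w\<in>words m k. pw w * exp (- t * g w))" for t
  have "(h has_real_derivative (\<Sum>w\<in>words m k. pw w * (- g w))) (at 0)"
    unfolding h_def by (auto intro!: derivative_eq_intros sum.cong)
  moreover have "(\<Sum>w\<in>words m k. pw w * (- g w)) = - (mean_log_ratio s k - ln C)"
    by (simp add: g_def mean_log_ratio_def right_diff_distrib sum_subtractf sum_negf sum_pw flip: sum_distrib_right)
  ultimately obtain \<delta> where "\<delta> > 0" "\<And>t. 0 < t \<Longrightarrow> t < \<delta> \<Longrightarrow> h (0 + t) < h 0"
    using mk DERIV_neg_dec_right[of h "- (mean_log_ratio s k - ln C)" 0] by auto
  moreover have "h 0 = 1" by (simp add: h_def sum_pw)
  ultimately obtain t where t: "t > 0" "h t < 1"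
    by (metis add_0 dense)
  have h0: "0 \<le> h t" unfolding h_def using pw_pos by (intro sum_nonneg) (simp add: less_imp_le)
  define S where "S n = (\<Sum>w\<in>words m n. pw w * exp (- t * g w))" for n
  have S0: "0 \<le> S n" for n
    unfolding S_def using pw_pos by (intro sum_nonneg) (simp add: less_imp_le)
  have S_add: "S (j + n) \<le> S j * S n" for j n
  proof -
    have "S (j + n) = (\<Sum>v\<in>words m j. \<Sum>w\<in>words m n. pw v * pw w * exp (- t * g (v @ w)))"
      by (simp add: S_def sum_words_add pw_append)
    also have "\<dots> \<le> (\<Sum>v\<in>words m j. \<Sum>w\<in>words m n. pw v * pw w * (exp (- t * g v) * exp (- t * g w)))"
    proof (intro sum_mono mult_left_mono)
      fix v w assume vw: "v \<in> words m j" "w \<in> words m n"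
      have "t * (g v + g w) \<le> t * g (v @ w)" using gg[OF vw] t by (intro mult_left_mono) auto
      then show "exp (- t * g (v @ w)) \<le> exp (- t * g v) * exp (- t * g w)"
        by (simp add: algebra_simps flip: exp_add)
      show "0 \<le> pw v * pw w" using pw_pos vw by (simp add: less_imp_le)
    qed
    also have "\<dots> = S j * S n" by (simp add: S_def sum_product mult_ac)
    finally show ?thesis .
  qed
  \<comment> \<open>Only positive powers: \<open>g []\<close> contains \<open>- ln C\<close>, so
    \<open>S 0\<close> may exceed 1. The case \<open>q = 0\<close> of the final bound rests on total
    mass 1 instead.\<close>
  have S_pow: "S (Suc q * k) \<le> h t ^ Suc q" for q
  proof (induction q)
    case 0 show ?case by (simp add: S_def h_def)
  next
    case (Suc q)
    have "S (Suc (Suc q) * k) \<le> S k * S (Suc q * k)" using S_add[of k "Suc q * k"] by simp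
    also have "\<dots> \<le> h t * h t ^ Suc q"
      using Suc h0 S0 by (intro mult_mono) (auto simp: S_def h_def)
    finally show ?case by simp
  qed
  have "(\<Sum>w\<in>{w \<in> words m (q * k). pw w < svf s (Tw w)}. pw w) \<le> h t ^ q" for q
  proof (cases q)
    case 0
    have "(\<Sum>w\<in>{w \<in> words m (q * k). pw w < svf s (Tw w)}. pw w) \<le> (\<Sum>w\<in>words m (q * k). pw w)"
      using pw_pos finite_words by (intro sum_mono2) (auto intro: less_imp_le)
    also have "\<dots> = h t ^ q" by (simp only: sum_pw 0 power_0)
    finally show ?thesis .
  next
    case (Suc q')
    \<comment> \<open>Chernoff's bound: on these words \<open>g w \<le> 0\<close>, so the
      exponential factor is at least 1.\<close>
    have "(\<Sum>w\<in>{w \<in> words m (q * k). pw w < svf s (Tw w)}. pw w)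
        \<le> (\<Sum>w\<in>{w \<in> words m (q * k). pw w < svf s (Tw w)}. pw w * exp (- t * g w))"
    proof (intro sum_mono)
      fix w assume "w \<in> {w \<in> words m (q * k). pw w < svf s (Tw w)}"
      then have w: "w \<in> words m (q * k)" "pw w < svf s (Tw w)" by auto
      have "ln (pw w) \<le> ln (svf s (Tw w))" using w pw_pos[OF w(1)] by (intro ln_mono) auto
      then have "g w \<le> 0" using ln_ge_zero[OF C(1)] by (simp add: g_def log_ratio_def)
      then have "exp (- t * g w) \<ge> 1" using t by (simp add: mult_nonneg_nonpos)
      then show "pw w \<le> pw w * exp (- t * g w)" using pw_pos[OF w(1)] by simp
    qed
    also have "\<dots> \<le> S (q * k)"
      unfolding S_def using pw_pos finite_words
      by (intro sum_mono2) (auto intro: less_imp_le)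
    also have "\<dots> \<le> h t ^ q" using S_pow[of q'] Suc by simp
    finally show ?thesis .
  qed
  then show ?thesis using that[of k "h t"] k t h0 by blast
qed

end

section \<open>Local dimension of the projected measure\<close>

text \<open>Upper semicontinuity of the mass of closed balls, by continuity from above along the
  radii \<open>r + 1 / real (Suc k)\<close>. It makes the set of good points in space Borel.\<close>

lemma closed_measure_cball_ge:
  fixes M :: "'a::metric_space measure"
  assumes "finite_measure M" "sets M = sets borel"
  shows "closed {x. c \<le> measure M (cball x r)}"
  unfolding closed_sequential_limits
proof (intro allI impI, elim conjE)
  fix f x assume f: "\<forall>n. f n \<in> {x. c \<le> measure M (cball x r)}" and lim: "f \<longlonglongrightarrow> x"
  interpret finite_measure M by fact
  have cb: "cball y s \<in> sets M" for y s by (simp add: assms(2))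
  define A where "A k = cball x (r + 1 / real (Suc k))" for k
  have "c \<le> measure M (A k)" for k
  proof -
    have "eventually (\<lambda>n. dist (f n) x < 1 / real (Suc k)) sequentially"
      using lim by (rule tendstoD) simp
    then obtain n where n: "dist (f n) x < 1 / real (Suc k)" by (auto simp: eventually_sequentially)
    have "cball (f n) r \<subseteq> A k"
    proof
      fix y assume "y \<in> cball (f n) r"
      then show "y \<in> A k" using n dist_triangle2[of x y "f n"] dist_triangle[of x y "f n"]
        by (simp add: A_def dist_commute)
    qed
    then have "measure M (cball (f n) r) \<le> measure M (A k)"
      using cb by (intro finite_measure_mono) (auto simp: A_def)
    moreover have "c \<le> measure M (cball (f n) r)" using f by simp
    ultimately show ?thesis by simp
  qed
  moreover have "(\<lambda>k. measure M (A k)) \<longlonglongrightarrow> measure M (\<Inter>k. A k)"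
  proof (rule finite_Lim_measure_decseq)
    show "range A \<subseteq> sets M" using cb by (auto simp: A_def)
    show "decseq A"
    proof (rule decseq_SucI)
      show "A (Suc k) \<subseteq> A k" for k
        unfolding A_def by (intro subset_cball add_left_mono divide_left_mono) auto
    qed
  qed
  ultimately have "c \<le> measure M (\<Inter>k. A k)" by (intro LIMSEQ_le_const) auto
  moreover have "(\<Inter>k. A k) = cball x r"
  proof
    show "cball x r \<subseteq> (\<Inter>k. A k)"
      unfolding A_def by (intro INT_greatest subset_cball) simp
    show "(\<Inter>k. A k) \<subseteq> cball x r"
    proof
      fix y assume "y \<in> (\<Inter>k. A k)"
      then have "dist x y \<le> r + 1 / real (Suc k)" for k by (auto simp: A_def)
      moreover have "(\<lambda>k. r + 1 / real (Suc k)) \<longlonglongrightarrow> r + 0"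
        by (intro tendsto_add tendsto_const LIMSEQ_Suc[OF lim_const_over_n])
      ultimately have "dist x y \<le> r + 0" by (intro LIMSEQ_le_const) auto
      then show "y \<in> cball x r" by simp
    qed
  qed
  ultimately show "x \<in> {x. c \<le> measure M (cball x r)}" by simp
qed

text \<open>The points lying in a covering ball whose mass is too small relative to the number of
  covering balls have total mass at most \<open>\<epsilon> q\<close>.\<close>

lemma AE_measure_cball_ge:
  fixes X :: "'a \<Rightarrow> 'b::{metric_space, second_countable_topology}"
  assumes "finite_measure M" and X[measurable]: "X \<in> borel_measurable M"
    and finW: "\<And>q. finite (W q)" and C: "\<And>q w. w \<in> W q \<Longrightarrow> C q w \<in> sets M"
    and sumC: "\<And>q. (\<Sum>w\<in>W q. measure M (C q w)) \<le> 1"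
    and finY: "\<And>q w. w \<in> W q \<Longrightarrow> finite (Y q w)"
    and cover: "\<And>q w. w \<in> W q \<Longrightarrow> X ` C q w \<subseteq> (\<Union>y\<in>Y q w. cball y (\<rho> q w))"
    and e: "\<And>q. 0 \<le> \<epsilon> q" "summable \<epsilon>"
  shows "AE u in M. eventually (\<lambda>q. \<forall>w\<in>W q. u \<in> C q w \<longrightarrow>
    \<epsilon> q * measure M (C q w) \<le> real (card (Y q w)) * measure (distr M borel X) (cball (X u) (2 * \<rho> q w))) sequentially"
proof -
  interpret finite_measure M by fact
  interpret D: finite_measure "distr M borel X" by (rule finite_measure_distr) measurable
  let ?D = "distr M borel X"
  \<comment> \<open>The light covering balls. Multiplying by their number rather than dividing
    avoids the default value of division when the covering is empty.\<close>
  define Z where "Z q w = {y \<in> Y q w. real (card (Y q w)) * measure ?D (cball y (\<rho> q w)) < \<epsilon> q * measure M (C q w)}" for q w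
  have finZ: "finite (Z q w)" if "w \<in> W q" for q w using finY[OF that] by (simp add: Z_def)
  define S where "S q w y = X -` cball y (\<rho> q w) \<inter> space M" for q w y
  have S: "S q w y \<in> sets M" for q w y unfolding S_def by measurable
  have mS: "measure M (S q w y) = measure ?D (cball y (\<rho> q w))" for q w y
    by (simp add: S_def measure_distr)
  define A where "A q = (\<Union>w\<in>W q. \<Union>y\<in>Z q w. S q w y)" for q
  have A: "A q \<in> sets M" for q
    unfolding A_def using finW finZ S by (intro sets.finite_UN) auto
  have inner: "(\<Sum>y\<in>Z q w. measure M (S q w y)) \<le> \<epsilon> q * measure M (C q w)" if w: "w \<in> W q" for q w
  proof (cases "Y q w = {}")
    case True then show ?thesis using e by (simp add: Z_def)
  next
    case False
    then have c: "0 < real (card (Y q w))" using finY[OF w] by (simp add: card_gt_0_iff)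
    have "real (card (Y q w)) * (\<Sum>y\<in>Z q w. measure M (S q w y))
        = (\<Sum>y\<in>Z q w. real (card (Y q w)) * measure ?D (cball y (\<rho> q w)))"
      by (simp add: sum_distrib_left mS)
    also have "\<dots> \<le> (\<Sum>y\<in>Z q w. \<epsilon> q * measure M (C q w))" by (intro sum_mono) (auto simp: Z_def)
    also have "\<dots> = real (card (Z q w)) * (\<epsilon> q * measure M (C q w))" by simp
    also have "\<dots> \<le> real (card (Y q w)) * (\<epsilon> q * measure M (C q w))"
      using finY[OF w] e by (intro mult_right_mono) (auto simp: Z_def card_mono)
    finally show ?thesis using c by simp
  qed
  have mA: "measure M (A q) \<le> \<epsilon> q" for q
  proof -
    have "measure M (A q) \<le> (\<Sum>w\<in>W q. measure M (\<Union>y\<in>Z q w. S q w y))"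
      unfolding A_def using finW finZ S by (intro finite_measure_subadditive_finite) (auto intro!: sets.finite_UN)
    also have "\<dots> \<le> (\<Sum>w\<in>W q. \<Sum>y\<in>Z q w. measure M (S q w y))"
      using finZ S by (intro sum_mono finite_measure_subadditive_finite) auto
    also have "\<dots> \<le> (\<Sum>w\<in>W q. \<epsilon> q * measure M (C q w))" by (intro sum_mono inner)
    also have "\<dots> \<le> \<epsilon> q * 1"
      using sumC[of q] e by (simp add: mult_left_le flip: sum_distrib_left)
    finally show ?thesis by simp
  qed
  have "summable (\<lambda>q. measure M (A q))"
    by (rule summable_comparison_test'[OF e(2)]) (use mA in auto)
  then have "AE u in M. eventually (\<lambda>q. u \<in> space M - A q) sequentially"
    using A by (intro borel_cantelli_AE1) (auto simp: emeasure_eq_measure)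
  then show ?thesis
  proof eventually_elim
    case (elim u)
    then show ?case
    proof eventually_elim
      case (elim q)
      show ?case
      proof (intro ballI impI)
        fix w assume w: "w \<in> W q" "u \<in> C q w"
        \<comment> \<open>Outside \<open>A q\<close> no covering ball that contains
          \<open>X u\<close> is light; doubling its radius allows it to be recentred at
          \<open>X u\<close>.\<close>
        then obtain y where y: "y \<in> Y q w" "X u \<in> cball y (\<rho> q w)" using cover[OF w(1)] by blast
        then have "u \<in> S q w y" using elim by (simp add: S_def)
        then have "y \<notin> Z q w" using elim w by (auto simp: A_def)
        then have "\<epsilon> q * measure M (C q w) \<le> real (card (Y q w)) * measure ?D (cball y (\<rho> q w))"
          using y by (simp add: Z_def)
        also have "\<dots> \<le> real (card (Y q w)) * measure ?D (cball (X u) (2 * \<rho> q w))"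
        proof (intro mult_left_mono D.finite_measure_mono)
          show "cball y (\<rho> q w) \<subseteq> cball (X u) (2 * \<rho> q w)"
          proof
            fix z assume "z \<in> cball y (\<rho> q w)"
            then show "z \<in> cball (X u) (2 * \<rho> q w)"
              using y(2) dist_triangle3[of "X u" z y] by simp
          qed
        qed auto
        finally show "\<epsilon> q * measure M (C q w) \<le> real (card (Y q w)) * measure ?D (cball (X u) (2 * \<rho> q w))" .
      qed
    qed
  qed
qed

text \<open>From a sequence of scales to all small radii. At the first \<open>q\<close> with
  \<open>K * R q \<le> r\<close> the preceding scale still exceeds \<open>r / K\<close>, so
  \<open>R q\<close> is at least \<open>\<beta> / K * r\<close>. The constants are absorbed by
  \<open>r powr (\<tau> - \<sigma>)\<close>, which tends to 0.\<close>

lemma eventually_powr_le_of_scales: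
  fixes G :: "real \<Rightarrow> real" and R :: "nat \<Rightarrow> real"
  assumes mono: "mono G" and R: "\<And>q. 0 < R q" "R \<longlonglongrightarrow> 0" "\<And>q. \<beta> * R q \<le> R (Suc q)"
    and pos: "0 < \<beta>" "0 < c" "0 < K" "0 \<le> \<sigma>" and "\<sigma> < \<tau>"
    and ev: "eventually (\<lambda>q. c * R q powr \<sigma> \<le> G (K * R q)) sequentially"
  shows "eventually (\<lambda>r. r powr \<tau> \<le> G r) (at_right 0)"
proof -
  obtain q0 where q0: "\<And>q. q \<ge> q0 \<Longrightarrow> c * R q powr \<sigma> \<le> G (K * R q)"
    using ev by (auto simp: eventually_sequentially)
  \<comment> \<open>Below \<open>r1\<close> no index up to \<open>q0\<close> qualifies, so the least
    index exceeds \<open>q0\<close> and has a predecessor.\<close>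
  define r1 where "r1 = K * Min (R ` {..q0})"
  have "r1 > 0" using R(1) pos by (simp add: r1_def)
  have "((\<lambda>r::real. r powr (\<tau> - \<sigma>)) \<longlongrightarrow> 0) (at_right 0)"
    using \<open>\<sigma> < \<tau>\<close>
    by (intro tendsto_zero_powrI[where b = "\<tau> - \<sigma>"] tendsto_ident_at tendsto_const)
       (auto simp: eventually_at_filter)
  moreover have "0 < c * (\<beta> / K) powr \<sigma>" using pos by simp
  ultimately have "eventually (\<lambda>r. r powr (\<tau> - \<sigma>) < c * (\<beta> / K) powr \<sigma>) (at_right 0)"
    by (rule order_tendstoD(2))
  moreover have "eventually (\<lambda>r. r < r1) (at_right 0)" "eventually (\<lambda>r::real. 0 < r) (at_right 0)"
    using \<open>r1 > 0\<close> by (auto simp: eventually_at_right_less eventually_at_right_field)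
  ultimately show ?thesis
  proof eventually_elim
    case (elim r)
    have "eventually (\<lambda>q. R q < r / K) sequentially"
      using R(2) elim pos by (intro order_tendstoD) auto
    then have ex: "\<exists>q. K * R q \<le> r"
      using pos by (force simp: eventually_sequentially field_simps intro: less_imp_le)
    define q where "q = (LEAST q. K * R q \<le> r)"
    have q: "K * R q \<le> r" unfolding q_def using ex by (rule LeastI_ex)
    have "q > q0"
    proof (rule ccontr)
      assume "\<not> q > q0"
      then have "Min (R ` {..q0}) \<le> R q" by (intro Min_le) auto
      then have "r1 \<le> K * R q" using pos by (simp add: r1_def)
      then show False using q elim by simp
    qed
    then obtain q' where q': "q = Suc q'" by (cases q) auto
    then have "r < K * R q'" using not_less_Least[of q' "\<lambda>q. K * R q \<le> r"] by (simp add: q_def)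
    then have "\<beta> / K * r \<le> \<beta> / K * (K * R q')" using pos by (intro mult_left_mono) auto
    also have "\<dots> \<le> R q" using R(3)[of q'] pos by (simp add: q')
    finally have "(\<beta> / K * r) powr \<sigma> \<le> R q powr \<sigma>"
      using pos elim by (intro powr_mono2) auto
    moreover have "(\<beta> / K * r) powr \<sigma> = (\<beta> / K) powr \<sigma> * r powr \<sigma>"
      by (rule powr_mult)
    ultimately have "c * ((\<beta> / K) powr \<sigma> * r powr \<sigma>) \<le> c * R q powr \<sigma>"
      using pos by simp
    also have "\<dots> \<le> G (K * R q)" using q0 \<open>q > q0\<close> by simp
    also have "\<dots> \<le> G r" using q mono by (simp add: monoD)
    finally have G: "c * (\<beta> / K) powr \<sigma> * r powr \<sigma> \<le> G r" by (simp add: mult_ac)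
    have "r powr \<tau> = r powr (\<tau> - \<sigma>) * r powr \<sigma>" by (simp flip: powr_add)
    also have "\<dots> \<le> c * (\<beta> / K) powr \<sigma> * r powr \<sigma>" using elim by (intro mult_right_mono) auto
    finally show ?case using G by simp
  qed
qed

section \<open>Prefixes, cylinders and the coding map\<close>

lemma pref_Suc: "pref u (Suc k) = pref u k @ [u k]"
  by (simp add: pref_def)

lemma length_pref [simp]: "length (pref u k) = k"
  by (simp add: pref_def)

lemma pref_in_words: "u \<in> code_space m \<Longrightarrow> pref u k \<in> words m k"
  by (auto simp: pref_def words_def code_space_def)

lemma take_pref: "j \<le> k \<Longrightarrow> take j (pref u k) = pref u j"
  by (simp add: pref_def take_map)

lemma pref_add: "pref u (k + j) = pref u k @ pref (\<lambda>i. u (k + i)) j"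
  by (rule nth_equalityI) (auto simp: pref_def nth_append)

lemma shift_code_space: "u \<in> code_space m \<Longrightarrow> (\<lambda>i. u (k + i)) \<in> code_space m"
  by (simp add: code_space_def)

lemma pref_sets: "{u. pref u k = w} \<in> sets borel"
proof -
  have coord: "open {u :: nat \<Rightarrow> nat. u i = x}" for i x
  proof -
    have "open ((\<lambda>u :: nat \<Rightarrow> nat. u i) -` {x})"
      by (intro open_vimage open_discrete continuous_on_product_coordinates)
    then show ?thesis by (simp add: vimage_def)
  qed
  have "{u. pref u k = w} = (if length w = k then (\<Inter>i\<in>{..<k}. {u. u i = w ! i}) else {})"
    by (auto simp: pref_def list_eq_iff_nth_eq)
  then show ?thesis using coord by (auto intro!: borel_open)
qed

locale bernoulli_ifs = linear_ifs T m p a b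
  for T :: "nat \<Rightarrow> real^'n \<Rightarrow> real^'n" and m p a b +
  fixes \<mu> :: "(nat \<Rightarrow> nat) measure" and \<omega> :: "nat list \<Rightarrow> real^'n" and R :: real
  assumes bern: "bernoulli_measure m p \<mu>"
    and R0: "0 < R" and omega_bd: "\<And>k w. w \<in> words m (Suc k) \<Longrightarrow> norm (\<omega> w) \<le> R"
begin

lemma sets_mu: "sets \<mu> = sets (restrict_space borel (code_space m))"
  using bern by (simp add: bernoulli_measure_def)

lemma space_mu: "space \<mu> = code_space m"
  using sets_eq_imp_space_eq[OF sets_mu] by (simp add: space_restrict_space)

lemma finite_measure_mu: "finite_measure \<mu>"
  using bern by (intro finite_measureI) (simp add: bernoulli_measure_def)

lemma measure_cylinder: "w \<in> words m k \<Longrightarrow> measure \<mu> (cylinder m w) = pw w"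
  using bern unfolding bernoulli_measure_def pw_def by blast

lemma sets_cylinder: "cylinder m w \<in> sets \<mu>"
proof -
  have "cylinder m w = code_space m \<inter> {u. pref u (length w) = w}" by (auto simp: cylinder_def)
  then show ?thesis unfolding sets_mu sets_restrict_space using pref_sets by blast
qed

lemma measurable_pref [measurable]: "(\<lambda>u. pref u k) \<in> measurable \<mu> (count_space UNIV)"
proof -
  have "(\<lambda>u. pref u k) \<in> measurable borel (count_space UNIV)"
    unfolding measurable_count_space_eq2_countable using pref_sets by (auto simp: vimage_def)
  then show ?thesis
    using measurable_restrict_space1 measurable_cong_sets[OF sets_mu refl] by blast
qed

lemma measurable_proj_pt [measurable]: "proj_pt T \<omega> \<in> borel_measurable \<mu>"
proof -
  have "(\<lambda>u. word_map T (pref u k) (\<omega> (pref u (Suc k)))) \<in> borel_measurable \<mu>" for k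
  proof -
    \<comment> \<open>\<open>butlast\<close> makes the term a function of one prefix, and every
      function on the discrete space of words is measurable.\<close>
    have "(\<lambda>u. (\<lambda>w. word_map T (butlast w) (\<omega> w)) (pref u (Suc k))) \<in> borel_measurable \<mu>"
      by (rule measurable_compose[OF measurable_pref]) simp
    then show ?thesis by (simp add: pref_Suc)
  qed
  then show ?thesis unfolding proj_pt_def[abs_def] by (rule borel_measurable_suminf)
qed

text \<open>The sum of the geometric series with terms \<open>a ^ i * R\<close>.\<close>

definition R' :: real where "R' = R / (1 - a)"

lemma R'_pos: "0 < R'"
  using R0 a1 by (simp add: R'_def)

text \<open>The words \<open>\<eta>\<close> are decoupled from \<open>v\<close> because the set is
  only almost self-affine: after the map of a prefix is factored out, the maps follow the shifted
  sequence, but the translations still depend on the whole word. A tail is thus not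
  \<open>proj_pt\<close> of the shifted sequence.\<close>

lemma tail_sum:
  assumes v: "v \<in> code_space m" and w: "\<And>i. \<exists>j. \<eta> i \<in> words m (Suc j)"
  shows "summable (\<lambda>i. Tw (pref v i) (\<omega> (\<eta> i)))"
    and "norm (\<Sum>i. Tw (pref v i) (\<omega> (\<eta> i))) \<le> R'"
proof -
  have le: "norm (Tw (pref v i) (\<omega> (\<eta> i))) \<le> a ^ i * R" for i
  proof -
    have "norm (Tw (pref v i) (\<omega> (\<eta> i))) \<le> a ^ i * norm (\<omega> (\<eta> i))"
      by (rule norm_Tw_le[OF pref_in_words[OF v]])
    also have "\<dots> \<le> a ^ i * R" using w[of i] omega_bd a0 by (auto intro!: mult_left_mono)
    finally show ?thesis .
  qed
  have geo: "(\<lambda>i. a ^ i * R) sums (1 / (1 - a) * R)"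
    using a0 a1 by (intro sums_mult2 geometric_sums) simp
  then have sg: "summable (\<lambda>i. a ^ i * R)" by (rule sums_summable)
  show "summable (\<lambda>i. Tw (pref v i) (\<omega> (\<eta> i)))"
    by (rule summable_comparison_test'[OF sg le])
  have "norm (\<Sum>i. Tw (pref v i) (\<omega> (\<eta> i))) \<le> (\<Sum>i. a ^ i * R)"
    by (rule norm_suminf_le[OF le sg])
  also have "\<dots> = R'" using sums_unique[OF geo] by (simp add: R'_def)
  finally show "norm (\<Sum>i. Tw (pref v i) (\<omega> (\<eta> i))) \<le> R'" .
qed

definition base_pt :: "nat list \<Rightarrow> real^'n" where
  "base_pt w = (\<Sum>i<length w. Tw (take i w) (\<omega> (take (Suc i) w)))"

lemma proj_pt_cylinder:
  assumes "w \<in> words m k" "u \<in> cylinder m w"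
  obtains z where "norm z \<le> R'" "proj_pt T \<omega> u = base_pt w + Tw w z"
proof -
  have u: "u \<in> code_space m" and pw: "pref u k = w" and len: "length w = k"
    using assms by (auto simp: cylinder_def words_def)
  define v where "v i = u (k + i)" for i
  have v: "v \<in> code_space m" unfolding v_def by (rule shift_code_space[OF u])
  define f where "f i = Tw (pref u i) (\<omega> (pref u (Suc i)))" for i
  define g where "g i = Tw (pref v i) (\<omega> (pref u (Suc (k + i))))" for i
  have ex: "\<exists>j. pref u (Suc i) \<in> words m (Suc j)" for i
    using pref_in_words[OF u] by blast
  have g: "summable g" "norm (\<Sum>i. g i) \<le> R'"
    using tail_sum[OF v, of "\<lambda>i. pref u (Suc (k + i))"] ex by (simp_all add: g_def[abs_def])
  have f: "summable f"
    using tail_sum[OF u, of "\<lambda>i. pref u (Suc i)"] ex by (simp add: f_def[abs_def])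
  have fg: "f (i + k) = Tw w (g i)" for i
    using pref_add[of u k i] by (simp add: f_def g_def v_def[abs_def] pw word_map_append add.commute)
  have "proj_pt T \<omega> u = (\<Sum>i. f i)" by (simp add: proj_pt_def f_def)
  also have "\<dots> = (\<Sum>i. f (i + k)) + (\<Sum>i<k. f i)" by (rule suminf_split_initial_segment[OF f])
  also have "(\<Sum>i<k. f i) = base_pt w"
    unfolding base_pt_def len by (intro sum.cong refl) (simp add: f_def take_pref flip: pw)
  also have "(\<Sum>i. f (i + k)) = Tw w (\<Sum>i. g i)"
    unfolding fg using linear_Tw[OF assms(1)]
    by (intro bounded_linear.suminf[OF _ g(1), symmetric]) (simp add: linear_conv_bounded_linear)
  finally show ?thesis using that[of "\<Sum>i. g i"] g(2) by (simp add: add.commute)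
qed

lemma proj_pt_cover:
  assumes w: "w \<in> words m k"
    and Y: "Tw w ` cball 0 1 \<subseteq> (\<Union>y\<in>Y. cball y \<rho>)"
  shows "proj_pt T \<omega> ` cylinder m w \<subseteq> (\<Union>y\<in>(\<lambda>y. base_pt w + R' *\<^sub>R y) ` Y. cball y (R' * \<rho>))"
proof
  fix x assume "x \<in> proj_pt T \<omega> ` cylinder m w"
  then obtain u where u: "u \<in> cylinder m w" "x = proj_pt T \<omega> u" by auto
  obtain z where z: "norm z \<le> R'" "x = base_pt w + Tw w z"
    using proj_pt_cylinder[OF w u(1)] u(2) by auto
  define z' where "z' = (1 / R') *\<^sub>R z"
  have z': "z = R' *\<^sub>R z'" using R'_pos by (simp add: z'_def)
  have "z' \<in> cball 0 1" using z(1) R'_pos by (simp add: z'_def divide_le_eq)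
  then obtain y where y: "y \<in> Y" "dist y (Tw w z') \<le> \<rho>" using Y by fastforce
  have "dist (base_pt w + R' *\<^sub>R y) x = R' * dist y (Tw w z')"
    using R'_pos by (simp add: z(2) z' linear_scale[OF linear_Tw[OF w]] dist_norm flip: scaleR_diff_right)
  also have "\<dots> \<le> R' * \<rho>" using y(2) R'_pos by (intro mult_left_mono) auto
  finally show "x \<in> (\<Union>y\<in>(\<lambda>y. base_pt w + R' *\<^sub>R y) ` Y. cball y (R' * \<rho>))" using y(1) by auto
qed

abbreviation \<nu> :: "(real^'n) measure" where "\<nu> \<equiv> proj_measure T \<omega> \<mu>"

lemma finite_measure_nu: "finite_measure \<nu>"
  unfolding proj_measure_def by (intro finite_measure.finite_measure_distr[OF finite_measure_mu]) measurable

lemma mono_nu: "mono (\<lambda>r. measure \<nu> (cball x r))"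
proof -
  interpret finite_measure \<nu> by (rule finite_measure_nu)
  show ?thesis by (intro monoI finite_measure_mono) (auto simp: proj_measure_def)
qed

section \<open>Lower bounds for the mass of balls at typical points\<close>

text \<open>The covering lemma is used with the empty word at every stage: its cylinder is the whole
  code space and its map the identity. At most \<open>(4 / \<rho> q) ^ CARD('n)\<close> balls of
  radius a constant times \<open>\<rho> q\<close> are needed, which yields the exponent
  \<open>N + \<delta>\<close>.\<close>

lemma AE_powr_le_dim:
  assumes "real CARD('n) < \<tau>"
  shows "AE u in \<mu>. eventually (\<lambda>r. r powr \<tau> \<le> measure \<nu> (cball (proj_pt T \<omega> u) r)) (at_right 0)"
proof -
  define N where "N = real CARD('n)"
  have N: "N > 0" by (simp add: N_def zero_less_card_finite)
  \<comment> \<open>Half of the gap pays for the summable factor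
    \<open>\<rho> q powr \<delta>\<close>, the other half for the constants.\<close>
  define \<delta> where "\<delta> = (\<tau> - N) / 2"
  have d: "\<delta> > 0" "N + \<delta> < \<tau>" using assms by (simp_all add: \<delta>_def N_def field_simps)
  define \<rho> where "\<rho> q = (1 / 2 :: real) ^ q" for q :: nat
  have rho: "\<rho> q > 0" "\<rho> q \<le> 1" for q by (simp_all add: \<rho>_def power_le_one)
  have sv1: "sv (id :: real^'n \<Rightarrow> real^'n) (Suc i) = 1" if "i < CARD('n)" for i
    using sv_lower[OF linear_id, of 1 i] sv_upper[OF linear_id, of 1 i] that by (force intro: antisym)
  have "\<exists>Y. finite Y \<and> real (card Y) \<le> (4 / \<rho> q) ^ CARD('n) \<and>
     (id :: real^'n \<Rightarrow> real^'n) ` cball 0 1 \<subseteq> (\<Union>y\<in>Y. cball y (N * \<rho> q))" for q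
  proof -
    obtain Y where Y: "finite Y" "real (card Y) \<le> (\<Prod>i<CARD('n). 4 * max 1 (sv (id :: real^'n \<Rightarrow> real^'n) (Suc i) / \<rho> q))"
      "(id :: real^'n \<Rightarrow> real^'n) ` cball 0 1 \<subseteq> (\<Union>y\<in>Y. cball y (real CARD('n) * \<rho> q))"
      using ellipsoid_cover[OF linear_id inj_on_id rho(1)[of q]] by blast
    have "(\<Prod>i<CARD('n). 4 * max 1 (sv (id :: real^'n \<Rightarrow> real^'n) (Suc i) / \<rho> q)) = (\<Prod>i<CARD('n). 4 / \<rho> q)"
      using rho[of q] by (intro prod.cong refl) (simp add: sv1 max_def)
    then show ?thesis using Y by (auto simp: N_def)
  qed
  then obtain Y where Y: "\<And>q. finite (Y q)" "\<And>q. real (card (Y q)) \<le> (4 / \<rho> q) ^ CARD('n)"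
    "\<And>q. (id :: real^'n \<Rightarrow> real^'n) ` cball 0 1 \<subseteq> (\<Union>y\<in>Y q. cball y (N * \<rho> q))" by metis
  define Y' where "Y' q = (\<lambda>y. base_pt [] + R' *\<^sub>R y) ` Y q" for q
  have cY': "real (card (Y' q)) \<le> (4 / \<rho> q) ^ CARD('n)" for q
    using card_image_le[OF Y(1)[of q], of "\<lambda>y. base_pt [] + R' *\<^sub>R y"] Y(2)[of q]
    unfolding Y'_def by linarith
  have "AE u in \<mu>. eventually (\<lambda>q. \<forall>w\<in>{[]}. u \<in> cylinder m w \<longrightarrow>
    (\<rho> q powr \<delta>) * measure \<mu> (cylinder m w)
      \<le> real (card (Y' q)) * measure (distr \<mu> borel (proj_pt T \<omega>)) (cball (proj_pt T \<omega> u) (2 * (R' * (N * \<rho> q))))) sequentially"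
  proof (rule AE_measure_cball_ge[OF finite_measure_mu measurable_proj_pt])
    show "(\<Sum>w\<in>{[]}. measure \<mu> (cylinder m w)) \<le> 1"
      using measure_cylinder[of "[]" 0] by (simp add: pw_def)
    show "proj_pt T \<omega> ` cylinder m w \<subseteq> (\<Union>y\<in>Y' q. cball y (R' * (N * \<rho> q)))" if "w \<in> {[]}" for w q
      using proj_pt_cover[where w = "[]" and k = 0 and Y = "Y q" and \<rho> = "N * \<rho> q"] Y(3)[of q] that
      by (simp add: Y'_def)
    have eq: "\<rho> q powr \<delta> = ((1 / 2) powr \<delta>) ^ q" for q
      by (simp add: \<rho>_def powr_realpow[symmetric] powr_powr mult.commute)
    have "(1 / 2 :: real) powr \<delta> < 1" using d powr_less_mono2[of \<delta> "1 / 2" 1] by simp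
    then show "summable (\<lambda>q. \<rho> q powr \<delta>)" unfolding eq by (intro summable_geometric) simp
  qed (use sets_cylinder Y(1) in \<open>auto simp: Y'_def\<close>)
  then show ?thesis
    using AE_space
  proof eventually_elim
    case (elim u)
    then have u: "u \<in> cylinder m []" by (simp add: cylinder_def space_mu pref_def)
    have m1: "measure \<mu> (cylinder m []) = 1" using measure_cylinder[of "[]" 0] by (simp add: pw_def)
    have "eventually (\<lambda>q. (1 / 4 ^ CARD('n)) * \<rho> q powr (N + \<delta>)
        \<le> measure \<nu> (cball (proj_pt T \<omega> u) (2 * R' * N * \<rho> q))) sequentially"
      using elim(1)
    proof eventually_elim
      case (elim q)
      define G where "G = measure \<nu> (cball (proj_pt T \<omega> u) (2 * R' * N * \<rho> q))"
      have "\<rho> q powr \<delta> \<le> real (card (Y' q)) * G"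
        using elim u m1 by (simp add: G_def proj_measure_def mult_ac)
      also have "\<dots> \<le> (4 / \<rho> q) ^ CARD('n) * G" using cY' by (intro mult_right_mono) (auto simp: G_def)
      also have "(4 / \<rho> q) ^ CARD('n) = 4 ^ CARD('n) / \<rho> q powr N"
        using rho[of q] by (simp add: power_divide N_def powr_realpow)
      finally show ?case using rho(1)[of q] unfolding G_def[symmetric]
        by (simp add: powr_add field_simps)
    qed
    then show ?case
    proof (rule eventually_powr_le_of_scales[OF mono_nu _ _ _ _ _ _ _ d(2), rotated -1])
      show "\<rho> \<longlonglongrightarrow> 0" unfolding \<rho>_def[abs_def] by (intro LIMSEQ_power_zero) simp
      show "1 / 2 * \<rho> q \<le> \<rho> (Suc q)" for q by (simp add: \<rho>_def)
    qed (use rho R'_pos N d in auto)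
  qed
qed

lemma AE_powr_le_pressure:
  assumes s: "0 < s" "s \<le> real CARD('n)" "0 < P s" and "s < \<tau>"
  shows "AE u in \<mu>. eventually (\<lambda>r. r powr \<tau> \<le> measure \<nu> (cball (proj_pt T \<omega> u) r)) (at_right 0)"
proof -
  obtain k \<theta> where k: "0 < k" and th: "0 \<le> \<theta>" "\<theta> < 1"
    and decay: "\<And>q. (\<Sum>w\<in>{w \<in> words m (q * k). pw w < svf s (Tw w)}. pw w) \<le> \<theta> ^ q"
    using exp_moment_decay[OF less_imp_le[OF s(1)] s(3)] by blast
  define N where "N = real CARD('n)"
  have N: "N > 0" by (simp add: N_def zero_less_card_finite)
  define \<delta> where "\<delta> = (\<tau> - s) / 2"
  have d: "\<delta> > 0" "s + \<delta> < \<tau>" using assms(4) by (simp_all add: \<delta>_def field_simps)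
  \<comment> \<open>Counted from 0, so that \<open>\<alpha> w\<close> is the singular value that
    \<open>cover_le_svf\<close> uses as radius.\<close>
  define l where "l = nat \<lceil>s\<rceil> - 1"
  have l1: "nat \<lceil>s\<rceil> = Suc l" using s unfolding l_def by simp
  have l: "l < CARD('n)" using l1 s(1,2) by linarith
  define \<alpha> where "\<alpha> w = sv (Tw w) (Suc l)" for w
  have apos: "0 < \<alpha> w" if "w \<in> words m j" for w j
    using sv_pos[OF linear_Tw[OF that] inj_Tw[OF that] l] by (simp add: \<alpha>_def)
  have aup: "\<alpha> w \<le> a ^ j" if "w \<in> words m j" for w j
    using sv_upper[OF linear_Tw[OF that] norm_Tw_le[OF that] l] by (simp add: \<alpha>_def)
  have astep: "b ^ i * \<alpha> w \<le> \<alpha> (w @ v)" if "w \<in> words m j" "v \<in> words m i" for w v i j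
    unfolding \<alpha>_def word_map_append
    using b0 by (intro sv_compose_ge linear_Tw[OF that(1)] linear_Tw[OF that(2)] norm_Tw_ge[OF that(2)] l) simp
  have "\<exists>Y. finite Y \<and> real (card Y) * \<alpha> w powr s \<le> 4 ^ CARD('n) * svf s (Tw w) \<and>
     Tw w ` cball 0 1 \<subseteq> (\<Union>y\<in>Y. cball y (N * \<alpha> w))" if "w \<in> words m j" for w j
    using cover_le_svf[OF linear_Tw[OF that] inj_Tw[OF that] s(1,2)] unfolding l1 \<alpha>_def N_def by metis
  then obtain Y where Y: "\<And>w j. w \<in> words m j \<Longrightarrow> finite (Y w)"
    "\<And>w j. w \<in> words m j \<Longrightarrow> real (card (Y w)) * \<alpha> w powr s \<le> 4 ^ CARD('n) * svf s (Tw w)"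
    "\<And>w j. w \<in> words m j \<Longrightarrow> Tw w ` cball 0 1 \<subseteq> (\<Union>y\<in>Y w. cball y (N * \<alpha> w))"
    by metis
  define Y' where "Y' w = (\<lambda>y. base_pt w + R' *\<^sub>R y) ` Y w" for w
  have cY': "card (Y' w) \<le> card (Y w)" if "w \<in> words m j" for w j
    unfolding Y'_def by (rule card_image_le[OF Y(1)[OF that]])
  \<comment> \<open>The summable factor may depend on the word only through its length. This one is
    geometric in \<open>q\<close> and, by \<open>aup\<close>, dominates
    \<open>\<alpha> w powr \<delta>\<close> for all words of length \<open>q * k\<close>.\<close>
  define \<epsilon> where "\<epsilon> q = (a ^ (q * k)) powr \<delta>" for q :: nat
  have 1: "AE u in \<mu>. eventually (\<lambda>q. \<forall>w\<in>words m (q * k). u \<in> cylinder m w \<longrightarrow>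
    \<epsilon> q * measure \<mu> (cylinder m w)
      \<le> real (card (Y' w)) * measure (distr \<mu> borel (proj_pt T \<omega>)) (cball (proj_pt T \<omega> u) (2 * (R' * (N * \<alpha> w))))) sequentially"
  proof (rule AE_measure_cball_ge[OF finite_measure_mu measurable_proj_pt])
    show "(\<Sum>w\<in>words m (q * k). measure \<mu> (cylinder m w)) \<le> 1" for q
      using sum_pw[of "q * k"] by (simp add: measure_cylinder)
    show "proj_pt T \<omega> ` cylinder m w \<subseteq> (\<Union>y\<in>Y' w. cball y (R' * (N * \<alpha> w)))"
      if "w \<in> words m (q * k)" for w q
      unfolding Y'_def by (rule proj_pt_cover[OF that Y(3)[OF that]])
    have eq: "\<epsilon> q = ((a ^ k) powr \<delta>) ^ q" for q
      using a0 by (simp add: \<epsilon>_def powr_powr powr_realpow[symmetric] mult_ac)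
    have "(a ^ k) powr \<delta> < 1 powr \<delta>"
      using a0 a1 k d by (intro powr_less_mono2) (auto simp: power_Suc_less_one power_less_one_iff)
    then show "summable \<epsilon>" unfolding eq[abs_def] by (intro summable_geometric) simp
    show "0 \<le> \<epsilon> q" for q by (simp add: \<epsilon>_def)
    show "finite (Y' w)" if "w \<in> words m (q * k)" for w q using Y(1)[OF that] by (simp add: Y'_def)
  qed (use sets_cylinder finite_words in auto)
  \<comment> \<open>Sequences whose prefix of length \<open>q * k\<close> weighs less than its
    singular value function; by \<open>decay\<close> their measures are summable.\<close>
  define A where "A q = (\<Union>w\<in>{w \<in> words m (q * k). pw w < svf s (Tw w)}. cylinder m w)" for q
  have fin: "finite {w \<in> words m (q * k). pw w < svf s (Tw w)}" for q
    using finite_words by simp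
  interpret finite_measure \<mu> by (rule finite_measure_mu)
  have mA: "measure \<mu> (A q) \<le> \<theta> ^ q" for q
  proof -
    have "measure \<mu> (A q) \<le> (\<Sum>w\<in>{w \<in> words m (q * k). pw w < svf s (Tw w)}. measure \<mu> (cylinder m w))"
      unfolding A_def using fin sets_cylinder by (intro finite_measure_subadditive_finite) auto
    also have "\<dots> = (\<Sum>w\<in>{w \<in> words m (q * k). pw w < svf s (Tw w)}. pw w)"
      by (intro sum.cong refl) (auto simp: measure_cylinder)
    finally show ?thesis using decay[of q] by simp
  qed
  have "summable (\<lambda>q. \<theta> ^ q)" using th by (intro summable_geometric) simp
  then have "summable (\<lambda>q. measure \<mu> (A q))"
    by (rule summable_comparison_test') (simp add: mA)
  moreover have "A q \<in> sets \<mu>" for q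
    unfolding A_def using fin sets_cylinder by (intro sets.finite_UN) auto
  ultimately have 2: "AE u in \<mu>. eventually (\<lambda>q. u \<in> space \<mu> - A q) sequentially"
    by (intro borel_cantelli_AE1) (auto simp: emeasure_eq_measure)
  show ?thesis using 1 2 AE_space
  proof eventually_elim
    case (elim u)
    then have u: "u \<in> code_space m" by (simp add: space_mu)
    define w where "w q = pref u (q * k)" for q
    have w: "w q \<in> words m (q * k)" for q unfolding w_def by (rule pref_in_words[OF u])
    have uw: "u \<in> cylinder m (w q)" for q using u by (simp add: cylinder_def w_def)
    have "eventually (\<lambda>q. (1 / 4 ^ CARD('n)) * \<alpha> (w q) powr (s + \<delta>)
        \<le> measure \<nu> (cball (proj_pt T \<omega> u) (2 * R' * N * \<alpha> (w q)))) sequentially"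
      using elim(1,2)
    proof eventually_elim
      case (elim q)
      define G where "G = measure \<nu> (cball (proj_pt T \<omega> u) (2 * R' * N * \<alpha> (w q)))"
      have G0: "0 \<le> G" by (simp add: G_def)
      define V where "V = svf s (Tw (w q))"
      have V: "0 < V" using svf_Tw_pos[OF w less_imp_le[OF s(1)]] by (simp add: V_def)
      have \<alpha>: "0 < \<alpha> (w q)" using apos[OF w] .
      have "V \<le> pw (w q)" using elim(2) w[of q] uw[of q] by (force simp: A_def V_def)
      moreover have "\<alpha> (w q) powr \<delta> \<le> \<epsilon> q"
        unfolding \<epsilon>_def using aup[OF w] \<alpha> d by (intro powr_mono2) auto
      ultimately have "\<alpha> (w q) powr \<delta> * V \<le> \<epsilon> q * measure \<mu> (cylinder m (w q))"
        using V by (simp add: measure_cylinder[OF w] mult_mono \<epsilon>_def)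
      also have "\<dots> \<le> real (card (Y' (w q))) * G"
        using elim(1)[rule_format, OF w uw] unfolding G_def proj_measure_def by (simp add: mult.assoc)
      also have "\<dots> \<le> real (card (Y (w q))) * G"
        using cY'[OF w] G0 by (intro mult_right_mono) auto
      \<comment> \<open>The factor \<open>\<alpha> (w q) powr s\<close> turns the number of balls
        into at most \<open>4 ^ CARD('n) * V\<close>, after which \<open>V\<close> cancels.\<close>
      finally have "\<alpha> (w q) powr s * (\<alpha> (w q) powr \<delta> * V)
          \<le> \<alpha> (w q) powr s * (real (card (Y (w q))) * G)"
        by (intro mult_left_mono) auto
      also have "\<dots> = (real (card (Y (w q))) * \<alpha> (w q) powr s) * G" by (simp add: mult_ac)
      also have "\<dots> \<le> (4 ^ CARD('n) * V) * G"
        using Y(2)[OF w, of q] G0 by (intro mult_right_mono) (simp_all add: V_def)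
      finally have "V * \<alpha> (w q) powr (s + \<delta>) \<le> V * (4 ^ CARD('n) * G)"
        by (simp add: powr_add mult_ac)
      then have "\<alpha> (w q) powr (s + \<delta>) \<le> 4 ^ CARD('n) * G" using V by simp
      then show ?case unfolding G_def[symmetric] by (simp add: field_simps)
    qed
    then show ?case
    proof (rule eventually_powr_le_of_scales[OF mono_nu _ _ _ _ _ _ _ d(2), rotated -1])
      show "0 < \<alpha> (w q)" for q by (rule apos[OF w])
      show "b ^ k * \<alpha> (w q) \<le> \<alpha> (w (Suc q))" for q
      proof -
        \<comment> \<open>Passing to \<open>Suc q\<close> appends \<open>k\<close> letters, so
          \<open>astep\<close> bounds the loss of scale by \<open>b ^ k\<close>.\<close>
        have "w (Suc q) = w q @ pref (\<lambda>i. u (q * k + i)) k"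
          using pref_add[of u "q * k" k] by (simp add: w_def add.commute)
        then show ?thesis using astep[OF w pref_in_words[OF shift_code_space[OF u]]] by simp
      qed
      have "(\<lambda>q. (a ^ k) ^ q) \<longlonglongrightarrow> 0"
        using a0 a1 k by (intro LIMSEQ_power_zero) (simp add: power_less_one_iff)
      then show "(\<lambda>q. \<alpha> (w q)) \<longlonglongrightarrow> 0"
      proof (rule tendsto_sandwich[rotated 2, OF tendsto_const])
        show "eventually (\<lambda>q. 0 \<le> \<alpha> (w q)) sequentially"
          using apos[OF w] by (intro always_eventually) (simp add: less_imp_le)
        show "eventually (\<lambda>q. \<alpha> (w q) \<le> (a ^ k) ^ q) sequentially"
          using aup[OF w] by (intro always_eventually) (simp add: power_mult[symmetric] mult.commute)
      qed
    qed (use R'_pos N d s b0 in auto)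
  qed
qed

section \<open>From sequences to points of space\<close>

text \<open>The transfer to the image measure needs the property to be Borel in \<open>x\<close>. It
  involves uncountably many radii, but each contributes a closed set; so every \<open>F n\<close> is
  closed and their countable union is Borel.\<close>

lemma AE_nu_powr_le:
  assumes "AE u in \<mu>. eventually (\<lambda>r. r powr \<tau> \<le> measure \<nu> (cball (proj_pt T \<omega> u) r)) (at_right 0)"
  shows "AE x in \<nu>. eventually (\<lambda>r. r powr \<tau> \<le> measure \<nu> (cball x r)) (at_right 0)"
proof -
  define F where "F n = (\<Inter>r\<in>{0<..<1 / real (Suc n)}. {x. r powr \<tau> \<le> measure \<nu> (cball x r)})" for n
  have "closed (F n)" for n
    unfolding F_def
    by (intro closed_INT ballI closed_measure_cball_ge finite_measure_nu) (simp add: proj_measure_def)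
  then have "(\<Union>n. F n) \<in> sets borel" by (intro sets.countable_UN) auto
  moreover have eq: "{x. eventually (\<lambda>r. r powr \<tau> \<le> measure \<nu> (cball x r)) (at_right 0)} = (\<Union>n. F n)"
  proof (intro set_eqI iffI)
    fix x assume "x \<in> {x. eventually (\<lambda>r. r powr \<tau> \<le> measure \<nu> (cball x r)) (at_right 0)}"
    then obtain c where c: "c > 0" "\<And>r. 0 < r \<Longrightarrow> r < c \<Longrightarrow> r powr \<tau> \<le> measure \<nu> (cball x r)"
      by (auto simp: eventually_at_right_field)
    obtain n where "1 / real (Suc n) < c" using nat_approx_posE[OF c(1)] by metis
    then have "x \<in> F n" using c(2) by (auto simp: F_def)
    then show "x \<in> (\<Union>n. F n)" by blast
  next
    fix x assume "x \<in> (\<Union>n. F n)"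
    then obtain n where "x \<in> F n" by blast
    then show "x \<in> {x. eventually (\<lambda>r. r powr \<tau> \<le> measure \<nu> (cball x r)) (at_right 0)}"
      by (auto simp: F_def eventually_at_right_field intro!: exI[of _ "1 / real (Suc n)"])
  qed
  ultimately have "{x \<in> space borel. eventually (\<lambda>r. r powr \<tau> \<le> measure \<nu> (cball x r)) (at_right 0)} \<in> sets borel"
    by simp
  then show ?thesis
    using assms unfolding proj_measure_def by (subst AE_distr_iff) auto
qed

lemma AE_nu_Limsup_le:
  assumes "AE x in \<nu>. eventually (\<lambda>r. r powr \<tau> \<le> measure \<nu> (cball x r)) (at_right 0)"
  shows "AE x in \<nu>. Limsup (at_right 0) (\<lambda>r. eln (measure \<nu> (cball x r)) / ereal (ln r)) \<le> ereal \<tau>"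
  using assms
proof eventually_elim
  case (elim x)
  have "eventually (\<lambda>r. eln (measure \<nu> (cball x r)) / ereal (ln r) \<le> ereal \<tau>) (at_right 0)"
    using elim eventually_at_right_real[OF zero_less_one]
  proof eventually_elim
    case (elim r)
    then have r: "0 < r" "r < 1" by auto
    then have ln: "ln r < 0" by simp
    have "0 < r powr \<tau>" using r by simp
    \<comment> \<open>This excludes the value \<open>-\<infinity>\<close> of \<open>eln\<close>,
      whose quotient by the negative number \<open>ln r\<close> would be infinite.\<close>
    then have pos: "0 < measure \<nu> (cball x r)" using elim(1) by linarith
    have "ln (r powr \<tau>) \<le> ln (measure \<nu> (cball x r))" using elim r pos by (intro ln_mono) auto
    then have "\<tau> * ln r \<le> ln (measure \<nu> (cball x r))" using r by (simp add: ln_powr)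
    then have "ln (measure \<nu> (cball x r)) / ln r \<le> \<tau>" using ln by (simp add: divide_le_eq)
    then show ?case using pos ln by (simp add: eln_def)
  qed
  then show ?case by (rule Limsup_bounded)
qed

lemma pressure_eq_P:
  assumes "0 \<le> s"
  shows "pressure m T \<mu> s = P s"
proof -
  have "1 / real k * (\<Sum>w\<in>words m k. measure \<mu> (cylinder m w) *
      ln (inverse (svf s (word_map T w)) * measure \<mu> (cylinder m w))) = mean_log_ratio s k / real k" for k
  proof -
    have "(\<Sum>w\<in>words m k. measure \<mu> (cylinder m w) *
      ln (inverse (svf s (word_map T w)) * measure \<mu> (cylinder m w))) = mean_log_ratio s k"
      unfolding mean_log_ratio_def
    proof (intro sum.cong refl)
      fix w assume w: "w \<in> words m k"
      then show "measure \<mu> (cylinder m w) * ln (inverse (svf s (word_map T w)) * measure \<mu> (cylinder m w))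
          = pw w * log_ratio s w"
        using svf_Tw_pos[OF w assms] pw_pos[OF w]
        by (simp add: measure_cylinder log_ratio_def ln_mult_pos ln_inverse)
    qed
    then show ?thesis by simp
  qed
  then show ?thesis unfolding pressure_def P_def by (simp only:)
qed

text \<open>The definite description is justified by \<open>P_zero_exists\<close>, since both forms
  of the pressure agree at positive arguments.\<close>

lemma pressure_zero_props: "0 < pressure_zero m T \<mu>" "P (pressure_zero m T \<mu>) = 0"
proof -
  have "\<exists>!d. 0 < d \<and> pressure m T \<mu> d = 0"
    using P_zero_exists pressure_eq_P by (metis less_imp_le)
  then have "0 < pressure_zero m T \<mu> \<and> pressure m T \<mu> (pressure_zero m T \<mu>) = 0"
    unfolding pressure_zero_def by (rule theI')
  then show "0 < pressure_zero m T \<mu>" "P (pressure_zero m T \<mu>) = 0"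
    using pressure_eq_P by auto
qed

lemma upper_local_dimension_le:
  "AE x in \<nu>. Limsup (at_right 0) (\<lambda>r. eln (measure \<nu> (cball x r)) / ereal (ln r))
     \<le> ereal (min (pressure_zero m T \<mu>) (real CARD('n)))"
proof -
  define d where "d = min (pressure_zero m T \<mu>) (real CARD('n))"
  have "AE u in \<mu>. eventually (\<lambda>r. r powr \<tau> \<le> measure \<nu> (cball (proj_pt T \<omega> u) r)) (at_right 0)"
    if "d < \<tau>" for \<tau>
  proof (cases "pressure_zero m T \<mu> < real CARD('n)")
    case True
    \<comment> \<open>Any parameter strictly between the zero and \<open>\<tau>\<close> has positive
      pressure. The cap keeps it in the range of the covering bound, and it stays above
      \<open>d\<close>, which in this case is below the dimension.\<close>
    define s where "s = min ((d + \<tau>) / 2) (real CARD('n))"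
    have dd: "d = pressure_zero m T \<mu>" using True by (simp add: d_def)
    then have s: "d < s" "s < \<tau>" "s \<le> real CARD('n)"
      using that True by (auto simp: s_def min_def)
    have "0 < P s" using P_strict_mono[of d s] s pressure_zero_props dd by simp
    then show ?thesis using s pressure_zero_props dd by (intro AE_powr_le_pressure[of s]) auto
  next
    case False
    then show ?thesis using that by (intro AE_powr_le_dim) (simp add: d_def)
  qed
  \<comment> \<open>The exceptional null set depends on \<open>\<tau>\<close>, so only countably
    many values decreasing to \<open>d\<close> are used.\<close>
  then have "AE x in \<nu>. Limsup (at_right 0) (\<lambda>r. eln (measure \<nu> (cball x r)) / ereal (ln r))
      \<le> ereal (d + 1 / real (Suc n))" for n
    by (intro AE_nu_Limsup_le AE_nu_powr_le) simp
  then have "AE x in \<nu>. \<forall>n. Limsup (at_right 0) (\<lambda>r. eln (measure \<nu> (cball x r)) / ereal (ln r))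
      \<le> ereal (d + 1 / real (Suc n))"
    by (simp add: AE_all_countable)
  then show ?thesis
  proof eventually_elim
    case (elim x)
    have "(\<lambda>n. ereal (d + 1 / real (Suc n))) \<longlonglongrightarrow> ereal (d + 0)"
      by (intro tendsto_intros tendsto_ereal LIMSEQ_Suc[OF lim_const_over_n])
    then show ?case using elim by (intro LIMSEQ_le_const) (auto simp: d_def)
  qed
qed

end

section \<open>Uniform constants from the hypotheses on maps and translations\<close>

theorem proposition5p2:
  fixes T :: "nat \<Rightarrow> real^'n \<Rightarrow> real^'n"
    and m :: nat
    and p :: "nat \<Rightarrow> real"
    and \<mu> :: "(nat \<Rightarrow> nat) measure"
    and \<omega> :: "nat list \<Rightarrow> real^'n"
    and B :: "(real^'n) set"
  assumes "m \<ge> 2"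
    and "\<And>i. i \<in> {1..m} \<Longrightarrow> linear_contraction (T i)"
    and "\<And>i. i \<in> {1..m} \<Longrightarrow> bij (T i)"
    and "\<And>i. i \<in> {1..m} \<Longrightarrow> p i > 0"
    and "(\<Sum>i=1..m. p i) = 1"
    and "bernoulli_measure m p \<mu>"
    and "compact B" and "B \<noteq> {}"
    and "\<And>k w. k \<ge> 1 \<Longrightarrow> w \<in> words m k \<Longrightarrow> (\<lambda>x. T (last w) x + \<omega> w) ` B \<subseteq> B"
  shows "AE x in proj_measure T \<omega> \<mu>.
           Limsup (at_right 0)
             (\<lambda>r. eln (measure (proj_measure T \<omega> \<mu>) (cball x r)) / ereal (ln r))
           \<le> ereal (min (pressure_zero m T \<mu>) (real CARD('n)))"
proof -
  have lin: "linear (T i)" and on: "onorm (T i) < 1" if "i \<in> {1..m}" for i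
    using assms(2)[OF that] by (auto simp: linear_contraction_def)
  have bl: "bounded_linear (T i)" if "i \<in> {1..m}" for i
    using lin[OF that] by (simp add: linear_conv_bounded_linear)
  define a where "a = Max ((\<lambda>i. onorm (T i)) ` {1..m})"
  have ne: "{1..m} \<noteq> {}" using assms(1) by simp
  have a1: "a < 1" unfolding a_def using ne on by simp
  have norm_le: "norm (T i v) \<le> a * norm v" if i: "i \<in> {1..m}" for i v
  proof -
    have "norm (T i v) \<le> onorm (T i) * norm v" by (rule onorm[OF bl[OF i]])
    also have "\<dots> \<le> a * norm v" unfolding a_def using i by (intro mult_right_mono Max_ge) auto
    finally show ?thesis .
  qed
  have "\<exists>c>0. \<forall>v. c * norm v \<le> norm (T i v)" if i: "i \<in> {1..m}" for i
    using linear_inj_bounded_below_pos[OF lin[OF i] bij_is_inj[OF assms(3)[OF i]]] by metis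
  then obtain c where c: "\<And>i. i \<in> {1..m} \<Longrightarrow> 0 < c i" "\<And>i v. i \<in> {1..m} \<Longrightarrow> c i * norm v \<le> norm (T i v)"
    by metis
  define b where "b = Min (c ` {1..m})"
  have b0: "0 < b" unfolding b_def using ne c(1) by simp
  have norm_ge: "b * norm v \<le> norm (T i v)" if i: "i \<in> {1..m}" for i v
  proof -
    have "b * norm v \<le> c i * norm v" unfolding b_def using i by (intro mult_right_mono Min_le) auto
    then show ?thesis using c(2)[OF i, of v] by simp
  qed
  obtain K where K: "0 < K" "\<And>x. x \<in> B \<Longrightarrow> norm x \<le> K"
    using compact_imp_bounded[OF assms(7)] by (auto simp: bounded_pos)
  obtain x where x: "x \<in> B" using assms(8) by blast
  \<comment> \<open>\<open>\<omega> w\<close> is a point of \<open>B\<close> minus the image of a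
    point of \<open>B\<close> under a contraction; both have norm at most \<open>K\<close>.\<close>
  have om: "norm (\<omega> w) \<le> 2 * K" if w: "w \<in> words m (Suc k)" for w k
  proof -
    have "last w \<in> set w" using w by (intro last_in_set) (auto simp: words_def)
    then have i: "last w \<in> {1..m}" using w by (auto simp: words_def)
    have "T (last w) x + \<omega> w \<in> B" using assms(9)[OF _ w] x by auto
    then have "norm (T (last w) x + \<omega> w) \<le> K" by (rule K(2))
    moreover have "norm (T (last w) x) \<le> 1 * norm x"
      using norm_le[OF i, of x] a1 mult_right_mono[of a 1 "norm x"] by simp
    moreover have "norm x \<le> K" using K(2)[OF x] .
    moreover have "norm (\<omega> w) \<le> norm (T (last w) x + \<omega> w) + norm (T (last w) x)"
      using norm_triangle_ineq4[of "T (last w) x + \<omega> w" "T (last w) x"] by simp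
    ultimately show ?thesis by simp
  qed
  interpret bernoulli_ifs T m p a b \<mu> \<omega> "2 * K"
  proof
    show "2 \<le> m" "sum p {1..m} = 1" "bernoulli_measure m p \<mu>" "0 < 2 * K"
      using assms(1,5,6) K(1) by auto
  qed (simp_all add: linear_add[OF lin] linear_scale[OF lin] norm_le norm_ge b0 a1 assms(4) om)
  show ?thesis by (rule upper_local_dimension_le)
qed

end
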